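(* Let $T$ be a tree on $n\geq 4$ vertices with exactly $p$ leaves, and suppose $T$ is not a star. Let $B$ be any set output by the algorithm described in the context (for any admissible choices made during its execution). Then $B$ has exactly $2(n-p)$ elements, the rows of $\mathrm{Max4PC}_T$ indexed by the elements of $B$ form a basis of the row space of $\mathrm{Max4PC}_T$, and $$\det \mathrm{Max4PC}_T[B,B]=(-1)^{n-p}\,2^{2(n-p-1)}.$$
   Context: For a tree $T$ with vertex set $V$, $|V|=n$, let $d_{x,y}$ denote the distance between vertices $x,y$ in $T$. $\mathrm{Max4PC}_T$ is the $\binom{n}{2}\times\binom{n}{2}$ matrix with rows and columns indexed by the $2$-element subsets of $V$, whose entry in row $\{w,x\}$ and column $\{y,z\}$ is $\max\{d_{w,x}+d_{y,z},\ d_{w,y}+d_{x,z},\ d_{w,z}+d_{x,y}\}$. $M[B,B]$ denotes the principal submatrix of $M$ on rows and columns in $B$. A leaf is a vertex of degree $1$. The line graph $\mathrm{LG}(T)$ has as vertices the edges $\{a,b\}$ of $T$ (which are $2$-element subsets of $V$), two being adjacent iff they share an endpoint. For a graph $G$, a cut vertex is a vertex whose removal increases the number of connected components, and a block is a maximal connected subgraph without a cut vertex of its own. The symmetric difference of two adjacent vertices $\{a,b\},\{b,c\}$ of $\mathrm{LG}(T)$ is the $2$-set $\{a,c\}$. Algorithm. Initialise $G=\mathrm{LG}(T)$, $B=\emptyset$, and a set $N=\emptyset$ ("next starting vertices"). Choose a leaf $\ell$ of $T$ with neighbour $q$ and set the starting vertex $s=\{\ell,q\}$. Then repeat: (Step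 1) Let $B_c$ be the unique block of the current graph $G$ containing $s$ ($s$ is not a cut vertex of $G$). (Step 2) If $B_c$ contains a cut vertex of $G$: choose one such cut vertex $c$ of $G$ in $B_c$; add all other cut vertices of $G$ lying in $B_c$ to $N$; add the two elements $s$ and $s\,\triangle\, c$ (symmetric difference) to $B$; replace $G$ by the graph obtained by deleting all edges of $B_c$ and then deleting all vertices of $B_c$ that are not cut vertices of $G$; set $s=c$ and return to Step 1. (Step 3) If $B_c$ contains no cut vertex of $G$: choose a vertex $c$ of $B_c$ with $c\neq s$; add $s$ and $c$ to $B$; replace $G$ by $G$ minus all vertices of $B_c$; if $N=\emptyset$, output $B$ and stop; otherwise remove some element from $N$, make it the new $s$, and return to Step 1. *)

theory Defs
  imports Complex_Main "HOL-Combinatorics.Permutations"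
begin

definition graph_reach :: "'v set \<Rightarrow> 'v set set \<Rightarrow> 'v \<Rightarrow> 'v \<Rightarrow> bool" where
  "graph_reach W F = (\<lambda>x y. {x, y} \<in> F \<and> x \<noteq> y \<and> x \<in> W \<and> y \<in> W)\<^sup>*\<^sup>*"

definition is_graph :: "'v set \<Rightarrow> 'v set set \<Rightarrow> bool" where
  "is_graph W F \<longleftrightarrow> (\<forall>e\<in>F. e \<subseteq> W \<and> card e = 2)"

definition graph_connected :: "'v set \<Rightarrow> 'v set set \<Rightarrow> bool" where
  "graph_connected W F \<longleftrightarrow> W \<noteq> {} \<and> (\<forall>x\<in>W. \<forall>y\<in>W. graph_reach W F x y)"

definition num_comps :: "'v set \<Rightarrow> 'v set set \<Rightarrow> nat" where
  "num_comps W F = card ((\<lambda>x. {y \<in> W. graph_reach W F x y}) ` W)"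

definition del_verts :: "'v set \<Rightarrow> 'v set set \<Rightarrow> 'v set \<Rightarrow> 'v set \<times> 'v set set" where
  "del_verts W F X = (W - X, {e \<in> F. e \<inter> X = {}})"

definition cut_vertex :: "'v set \<Rightarrow> 'v set set \<Rightarrow> 'v \<Rightarrow> bool" where
  "cut_vertex W F v \<longleftrightarrow> v \<in> W \<and>
     num_comps (fst (del_verts W F {v})) (snd (del_verts W F {v})) > num_comps W F"

definition subgraph :: "'v set \<times> 'v set set \<Rightarrow> 'v set \<times> 'v set set \<Rightarrow> bool" where
  "subgraph H G \<longleftrightarrow> fst H \<subseteq> fst G \<and> snd H \<subseteq> snd G \<and> (\<forall>e\<in>snd H. e \<subseteq> fst H)"

definition nonsep :: "'v set \<times> 'v set set \<Rightarrow> bool" where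
  "nonsep H \<longleftrightarrow> graph_connected (fst H) (snd H) \<and> (\<forall>v. \<not> cut_vertex (fst H) (snd H) v)"

definition is_block :: "'v set \<times> 'v set set \<Rightarrow> 'v set \<times> 'v set set \<Rightarrow> bool" where
  "is_block G H \<longleftrightarrow> subgraph H G \<and> nonsep H \<and>
     (\<forall>H'. subgraph H' G \<and> nonsep H' \<and> subgraph H H' \<longrightarrow> H' = H)"

definition is_tree :: "'a set \<Rightarrow> 'a set set \<Rightarrow> bool" where
  "is_tree V E \<longleftrightarrow> finite V \<and> is_graph V E \<and> graph_connected V E \<and> card E = card V - 1"

definition tdeg :: "'a set set \<Rightarrow> 'a \<Rightarrow> nat" where
  "tdeg E v = card {e \<in> E. v \<in> e}"

definition leaves :: "'a set \<Rightarrow> 'a set set \<Rightarrow> 'a set" where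
  "leaves V E = {v \<in> V. tdeg E v = 1}"

definition is_star :: "'a set \<Rightarrow> 'a set set \<Rightarrow> bool" where
  "is_star V E \<longleftrightarrow> (\<exists>v\<in>V. \<forall>e\<in>E. v \<in> e)"

definition tdist :: "'a set set \<Rightarrow> 'a \<Rightarrow> 'a \<Rightarrow> nat" where
  "tdist E x y = (LEAST k. ((\<lambda>a b. {a, b} \<in> E) ^^ k) x y)"

definition pairs :: "'a set \<Rightarrow> 'a set set" where
  "pairs V = {e. e \<subseteq> V \<and> card e = 2}"

definition max4pc :: "'a set set \<Rightarrow> 'a set \<Rightarrow> 'a set \<Rightarrow> real" where
  "max4pc E P Q = (THE m. \<exists>w x y z. P = {w, x} \<and> Q = {y, z} \<and>
      m = real (max (tdist E w x + tdist E y z) (max (tdist E w y + tdist E x z) (tdist E w z + tdist E x y))))"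

definition line_graph :: "'a set set \<Rightarrow> 'a set set \<times> 'a set set set" where
  "line_graph E = (E, {{e, f} | e f. e \<in> E \<and> f \<in> E \<and> e \<noteq> f \<and> e \<inter> f \<noteq> {}})"

definition det_on :: "'i set \<Rightarrow> ('i \<Rightarrow> 'i \<Rightarrow> real) \<Rightarrow> real" where
  "det_on B M = (\<Sum>p | p permutes B. of_int (sign p) * (\<Prod>i\<in>B. M i (p i)))"

definition rows_indep :: "'i set \<Rightarrow> 'i set \<Rightarrow> ('i \<Rightarrow> 'i \<Rightarrow> real) \<Rightarrow> bool" where
  "rows_indep C B M \<longleftrightarrow>
     (\<forall>c. (\<forall>y\<in>C. (\<Sum>w\<in>B. c w * M w y) = 0) \<longrightarrow> (\<forall>w\<in>B. c w = 0))"

definition rows_span :: "'i set \<Rightarrow> 'i set \<Rightarrow> ('i \<Rightarrow> 'i \<Rightarrow> real) \<Rightarrow> bool" where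
  "rows_span C B M \<longleftrightarrow>
     (\<forall>x\<in>C. \<exists>c. \<forall>y\<in>C. M x y = (\<Sum>w\<in>B. c w * M w y))"

definition rows_basis :: "'i set \<Rightarrow> 'i set \<Rightarrow> ('i \<Rightarrow> 'i \<Rightarrow> real) \<Rightarrow> bool" where
  "rows_basis C B M \<longleftrightarrow> B \<subseteq> C \<and> rows_indep C B M \<and> rows_span C B M"

definition sym_diff :: "'v set \<Rightarrow> 'v set \<Rightarrow> 'v set" where
  "sym_diff a b = (a - b) \<union> (b - a)"

definition the_block_of :: "'v set \<times> 'v set set \<Rightarrow> 'v \<Rightarrow> 'v set \<times> 'v set set \<Rightarrow> bool" where
  "the_block_of G s Bc \<longleftrightarrow> is_block G Bc \<and> s \<in> fst Bc \<and>
     (\<forall>H. is_block G H \<and> s \<in> fst H \<longrightarrow> H = Bc)"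

text \<open>alg_run G N s Bacc Bout: running the loop from Step 1 with current graph G,
  set N of next starting vertices, starting vertex s, and accumulated set Bacc
  can (for some admissible choices) terminate with output Bout.\<close>
inductive alg_run :: "'a set set \<times> 'a set set set \<Rightarrow> 'a set set \<Rightarrow> 'a set
                      \<Rightarrow> 'a set set \<Rightarrow> 'a set set \<Rightarrow> bool" where
  step2: "\<lbrakk> the_block_of G s Bc;
           c \<in> fst Bc; cut_vertex (fst G) (snd G) c;
           N' = N \<union> {v \<in> fst Bc. cut_vertex (fst G) (snd G) v \<and> v \<noteq> c};
           G' = del_verts (fst G) (snd G - snd Bc) {v \<in> fst Bc. \<not> cut_vertex (fst G) (snd G) v};
           alg_run G' N' c (Bacc \<union> {s, sym_diff s c}) Bout \<rbrakk>
         \<Longrightarrow> alg_run G N s Bacc Bout"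
| step3_stop: "\<lbrakk> the_block_of G s Bc;
           \<forall>v\<in>fst Bc. \<not> cut_vertex (fst G) (snd G) v;
           c \<in> fst Bc; c \<noteq> s; N = {} \<rbrakk>
         \<Longrightarrow> alg_run G N s Bacc (Bacc \<union> {s, c})"
| step3_next: "\<lbrakk> the_block_of G s Bc;
           \<forall>v\<in>fst Bc. \<not> cut_vertex (fst G) (snd G) v;
           c \<in> fst Bc; c \<noteq> s; s' \<in> N;
           alg_run (del_verts (fst G) (snd G) (fst Bc)) (N - {s'}) s' (Bacc \<union> {s, c}) Bout \<rbrakk>
         \<Longrightarrow> alg_run G N s Bacc Bout"

definition alg_output :: "'a set \<Rightarrow> 'a set set \<Rightarrow> 'a set set \<Rightarrow> bool" where
  "alg_output V E B \<longleftrightarrow> (\<exists>l q. l \<in> leaves V E \<and> {l, q} \<in> E \<and>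
      alg_run (line_graph E) {} {l, q} {} B)"

end

theory Submission
  imports Defs "Jordan_Normal_Form.Determinant"
begin

text \<open>Root \<open>T\<close> at the leaf where the algorithm starts. Each internal vertex \<open>v\<close> is the centre of one
  block of the line graph, and processing that block contributes the parent edge of \<open>v\<close> together
  with a pair made of the parent of \<open>v\<close> and an internal child of \<open>v\<close>, or of \<open>v\<close> and a leaf child
  if all children of \<open>v\<close> are leaves.

  The entry of \<open>max4pc\<close> at two pairs is the sum of the lengths of the two paths plus twice the
  number of edges separating them. Only internal edges separate pairs, so the matrix has the form
  \<open>X S X\<^sup>T\<close> with \<open>2 (n - p)\<close> integer columns, where \<open>S\<close> is a direct sum of \<open>n - p\<close> hyperbolic planes,
  one of weight \<open>1\<close> and the others of weight \<open>2\<close>. The rows of \<open>X\<close> indexed by the output of the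
  algorithm generate the whole integer lattice, so this square part of \<open>X\<close> is unimodular and the
  determinant is that of \<open>S\<close>.\<close>

section \<open>Determinants over arbitrary finite index sets\<close>

text \<open>The edge at the starting leaf \<open>r\<close> never separates two pairs, because only
  \<open>r\<close> lies beyond it. Its slot, that of the neighbour \<open>q\<close> of
  \<open>r\<close>, is free and carries the form \<open>len P * 1 + 1 * len Q\<close>, a plane of
  weight 1. The other n - p - 1 internal vertices stand for the edges between internal vertices,
  which count twice when they separate. A plane of weight w has determinant -w^2, whence the sign
  and the exponent.

  The obstacle is that the output depends on arbitrary choices, so the determinant of the square
  part of X is not computed. Instead every unit vector is written as an integer combination of its
  rows, whatever the choices were. An integer inverse forces determinant 1 or -1, and the sign
  cancels because this factor enters twice.

  That T is not a star is used here: \<open>q\<close> then has an internal child, so the output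
  contains a pair at distance 2. If all its pairs had distance 1, the column of lengths would agree
  with the constant column.\<close>

lemma det_on_reindex:
  assumes f: "bij_betw f K B" and fin: "finite K"
  shows "det_on B M = det_on K (\<lambda>i j. M (f i) (f j))"
proof -
  have inj: "inj_on f K" and B: "B = f ` K" using f by (auto simp: bij_betw_def)
  have bij: "bij_betw (map_permutation K f) {p. p permutes K} {p. p permutes B}"
  proof (rule bij_betw_byWitness[where f' = "map_permutation B (inv_into K f)"])
    show "\<forall>p\<in>{p. p permutes K}. map_permutation B (inv_into K f) (map_permutation K f p) = p"
      using map_permutation_compose_inv[OF f] inj by auto
    show "\<forall>p\<in>{p. p permutes B}. map_permutation K f (map_permutation B (inv_into K f) p) = p"
      using map_permutation_compose_inv[OF bij_betw_inv_into[OF f]] f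
      by (auto simp: bij_betw_inv_into_right)
    show "map_permutation K f ` {p. p permutes K} \<subseteq> {p. p permutes B}"
      using map_permutation_permutes[OF f] by auto
    show "map_permutation B (inv_into K f) ` {p. p permutes B} \<subseteq> {p. p permutes K}"
      using map_permutation_permutes[OF bij_betw_inv_into[OF f]] by auto
  qed
  have "det_on B M = (\<Sum>p | p permutes K. of_int (sign (map_permutation K f p)) *
      (\<Prod>i\<in>B. M i (map_permutation K f p i)))"
    unfolding det_on_def using sum.reindex_bij_betw[OF bij, symmetric] by simp
  also have "\<dots> = (\<Sum>p | p permutes K. of_int (sign p) * (\<Prod>i\<in>K. M (f i) (f (p i))))"
  proof (intro sum.cong refl)
    fix p assume "p \<in> {p. p permutes K}"
    then have p: "p permutes K" by simp
    have "(\<Prod>i\<in>B. M i (map_permutation K f p i)) = (\<Prod>i\<in>K. M (f i) (map_permutation K f p (f i)))"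
      unfolding B by (simp add: prod.reindex inj)
    also have "\<dots> = (\<Prod>i\<in>K. M (f i) (f (p i)))"
      by (intro prod.cong refl) (simp add: map_permutation_apply inj)
    finally show "of_int (sign (map_permutation K f p)) * (\<Prod>i\<in>B. M i (map_permutation K f p i))
        = of_int (sign p) * (\<Prod>i\<in>K. M (f i) (f (p i)))"
      using sign_map_permutation[OF inj p fin] by simp
  qed
  finally show ?thesis unfolding det_on_def .
qed

lemma det_on_eq_det:
  assumes "bij_betw f {0..<m} K"
  shows "det_on K M = det (mat m m (\<lambda>(i, j). M (f i) (f j)))"
proof -
  have "det_on K M = det_on {0..<m} (\<lambda>i j. M (f i) (f j))"
    by (rule det_on_reindex[OF assms]) simp
  also have "\<dots> = det (mat m m (\<lambda>(i, j). M (f i) (f j)))"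
    unfolding det_on_def det_def by (auto intro!: sum.cong prod.cong dest: permutes_in_image)
  finally show ?thesis .
qed

lemma det_on_cong:
  assumes "\<And>i j. i \<in> K \<Longrightarrow> j \<in> K \<Longrightarrow> M i j = M' i j"
  shows "det_on K M = det_on K M'"
  unfolding det_on_def using assms by (auto intro!: sum.cong prod.cong simp: permutes_in_image)

lemma det_on_mult:
  assumes fin: "finite K"
  shows "det_on K (\<lambda>i j. \<Sum>k\<in>K. P i k * Q k j) = det_on K P * det_on K Q"
proof -
  obtain f where f: "bij_betw f {0..<card K} K"
    using ex_bij_betw_nat_finite[OF fin] by blast
  let ?m = "card K"
  have "mat ?m ?m (\<lambda>(i, j). \<Sum>k\<in>K. P (f i) k * Q k (f j))
      = mat ?m ?m (\<lambda>(i, j). P (f i) (f j)) * mat ?m ?m (\<lambda>(i, j). Q (f i) (f j))"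
    by (rule eq_matI) (simp_all add: scalar_prod_def sum.reindex_bij_betw[OF f, symmetric])
  then show ?thesis
    unfolding det_on_eq_det[OF f] by (simp add: det_mult[of _ ?m])
qed

lemma det_on_transpose:
  assumes fin: "finite K"
  shows "det_on K (\<lambda>i j. M j i) = det_on K M"
proof -
  obtain f where f: "bij_betw f {0..<card K} K"
    using ex_bij_betw_nat_finite[OF fin] by blast
  let ?A = "mat (card K) (card K) (\<lambda>(i, j). M (f i) (f j))"
  have "mat (card K) (card K) (\<lambda>(i, j). M (f j) (f i)) = transpose_mat ?A"
    by (rule eq_matI) simp_all
  then show ?thesis
    unfolding det_on_eq_det[OF f] by (simp add: det_transpose[of _ "card K"])
qed

lemma det_on_identity:
  assumes fin: "finite K"
  shows "det_on K (\<lambda>i j. if i = j then 1 else 0) = 1"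
proof -
  obtain f where f: "bij_betw f {0..<card K} K"
    using ex_bij_betw_nat_finite[OF fin] by blast
  have "mat (card K) (card K) (\<lambda>(i, j). if f i = f j then 1 else 0) = (1\<^sub>m (card K) :: real mat)"
    using f by (intro eq_matI) (auto simp: bij_betw_def inj_on_def)
  then show ?thesis
    unfolding det_on_eq_det[OF f] by simp
qed

lemma det_on_Ints:
  assumes "\<And>i j. i \<in> K \<Longrightarrow> j \<in> K \<Longrightarrow> M i j \<in> \<int>"
  shows "det_on K M \<in> \<int>"
  unfolding det_on_def using assms
  by (intro Ints_sum Ints_mult Ints_prod) (auto simp: permutes_in_image)

lemma det_on_nonzero_kernel:
  assumes fin: "finite K" and "det_on K M \<noteq> 0"
    and c: "\<And>j. j \<in> K \<Longrightarrow> (\<Sum>i\<in>K. c i * M i j) = 0" and i: "i \<in> K"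
  shows "c i = 0"
proof -
  obtain f where f: "bij_betw f {0..<card K} K"
    using ex_bij_betw_nat_finite[OF fin] by blast
  let ?m = "card K"
  \<comment> \<open>Transposed, because \<open>c\<close> combines rows while the kernel criterion
    speaks of column vectors.\<close>
  let ?A = "mat ?m ?m (\<lambda>(i, j). M (f j) (f i))"
  let ?v = "vec ?m (\<lambda>i. c (f i))"
  have "det ?A \<noteq> 0"
    using assms(2) det_on_transpose[OF fin, of M] unfolding det_on_eq_det[OF f] by simp
  moreover have "?A *\<^sub>v ?v = 0\<^sub>v ?m"
  proof (rule eq_vecI)
    fix j assume "j < dim_vec (0\<^sub>v ?m :: real vec)"
    then have j: "j < ?m" by simp
    then have fj: "f j \<in> K" using f by (auto simp: bij_betw_def)
    have "(?A *\<^sub>v ?v) $ j = (\<Sum>i\<in>{0..<?m}. c (f i) * M (f i) (f j))"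
      using j by (simp add: scalar_prod_def mult.commute)
    also have "\<dots> = 0"
      using c[OF fj] sum.reindex_bij_betw[OF f, of "\<lambda>i. c i * M i (f j)"] by simp
    finally show "(?A *\<^sub>v ?v) $ j = 0\<^sub>v ?m $ j" using j by simp
  qed simp
  ultimately have v: "?v = 0\<^sub>v ?m"
    using det_0_iff_vec_prod_zero_field[of ?A ?m] by (metis mat_carrier vec_carrier)
  obtain a where a: "a < ?m" "i = f a" using i f by (fastforce simp: bij_betw_def)
  then show ?thesis using arg_cong[OF v, of "\<lambda>w. w $ a"] by simp
qed

text \<open>Both determinants are integers and their product is 1, so each is a unit of the
  integers. The square suffices, since the determinant is needed once for the matrix and once for
  its transpose.\<close>

lemma det_on_inverse_Ints:
  assumes fin: "finite K"
    and "\<And>i j. i \<in> K \<Longrightarrow> j \<in> K \<Longrightarrow> U i j \<in> \<int>"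
    and "\<And>i j. i \<in> K \<Longrightarrow> j \<in> K \<Longrightarrow> C i j \<in> \<int>"
    and inv: "\<And>i j. i \<in> K \<Longrightarrow> j \<in> K \<Longrightarrow> (\<Sum>k\<in>K. C i k * U k j) = (if i = j then 1 else 0)"
  shows "(det_on K U)\<^sup>2 = 1"
proof -
  have "det_on K C * det_on K U = det_on K (\<lambda>i j. if i = j then 1 else 0)"
    unfolding det_on_mult[OF fin, symmetric] by (rule det_on_cong) (rule inv)
  then have "det_on K C * det_on K U = 1" by (simp add: det_on_identity fin)
  moreover obtain a b where "det_on K C = of_int a" "det_on K U = of_int b"
    using det_on_Ints[of K C] det_on_Ints[of K U] assms by (auto elim!: Ints_cases)
  ultimately have "a * b = 1" "det_on K U = of_int b"
    by (simp_all flip: of_int_mult)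
  then show ?thesis by (auto simp: zmult_eq_1_iff)
qed

text \<open>The flip is a product of \<open>card I\<close> disjoint transpositions, and the
  induction peels off one of them.\<close>

lemma flip_second_permutes_sign:
  fixes I :: "'v set"
  assumes "finite I"
  shows "(\<lambda>(v, b). if v \<in> I then (v, \<not> b) else (v, b)) permutes (I \<times> UNIV)
    \<and> sign (\<lambda>(v, b). if v \<in> I then (v, \<not> b) else (v, b)) = (-1) ^ card I"
  using assms
proof (induction I)
  case empty
  have "(\<lambda>(v, b). if v \<in> ({} :: 'v set) then (v, \<not> b) else (v, b)) = id" by auto
  then show ?case by (simp only:) (auto simp: permutes_def sign_id)
next
  case (insert a I)
  let ?p = "\<lambda>J. \<lambda>(v, b). if v \<in> J then (v, \<not> b) else (v, b)"
  let ?t = "transpose (a, False) (a, True)"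
  have eq: "?p (insert a I) = ?t \<circ> ?p I"
    using insert.hyps by (auto simp: fun_eq_iff transpose_def)
  have p: "?p I permutes I \<times> UNIV" using insert.IH by blast
  have "?p I permutes insert a I \<times> UNIV"
    by (rule permutes_subset[OF p]) auto
  moreover have "?t permutes insert a I \<times> UNIV"
    by (rule permutes_swap_id) auto
  ultimately have "?p (insert a I) permutes insert a I \<times> UNIV"
    unfolding eq by (rule permutes_compose)
  moreover have "sign (?p (insert a I)) = sign ?t * sign (?p I)"
    unfolding eq
  proof (rule sign_compose)
    show "permutation (?p I)"
      using permutation_permutes p insert.hyps(1) by (meson finite_SigmaI finite)
  qed (rule permutation_swap_id)
  ultimately show ?case
    using insert by (simp add: sign_swap_id)
qed

text \<open>A single permutation survives in the Leibniz sum, the one exchanging the two indices of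
  every block. It meets each weight twice, hence the square.\<close>

lemma det_on_hyperbolic_blocks:
  assumes fin: "finite I"
  shows "det_on (I \<times> (UNIV :: bool set)) (\<lambda>i j. if fst i = fst j \<and> snd i \<noteq> snd j then w (fst i) else 0)
    = (-1) ^ card I * (\<Prod>v\<in>I. w v)\<^sup>2"
proof -
  let ?S = "\<lambda>i j. if fst i = fst j \<and> snd i \<noteq> snd j then w (fst i) else 0"
  let ?p = "\<lambda>(v, b). if v \<in> I then (v, \<not> b) else (v, b)"
  let ?K = "I \<times> (UNIV :: bool set)"
  note p = flip_second_permutes_sign[OF fin]
  have finK: "finite ?K" using fin by simp
  have zero: "(\<Prod>i\<in>?K. ?S i (p i)) = 0" if perm: "p permutes ?K" and ne: "p \<noteq> ?p" for p
  proof -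
    obtain i where i: "p i \<noteq> ?p i" using ne by blast
    have "i \<in> ?K"
    proof (rule ccontr)
      assume out: "i \<notin> ?K"
      then have "p i = i" by (rule permutes_not_in[OF perm])
      moreover have "?p i = i" using out by (cases i) simp
      ultimately show False using i by simp
    qed
    obtain v b where vb: "i = (v, b)" by (cases i)
    obtain v' b' where vb': "p i = (v', b')" by (cases "p i")
    have "?S i (p i) = 0" using i \<open>i \<in> ?K\<close> unfolding vb' unfolding vb by (cases b; cases b') (simp_all split: if_splits)
    with \<open>i \<in> ?K\<close> finK show ?thesis by (intro prod_zero bexI[of _ i])
  qed
  have "det_on ?K ?S = (\<Sum>p | p permutes ?K. if p = ?p then of_int (sign p) * (\<Prod>i\<in>?K. ?S i (p i)) else 0)"
    unfolding det_on_def using zero by (intro sum.cong refl) auto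
  also have "\<dots> = of_int (sign ?p) * (\<Prod>i\<in>?K. ?S i (?p i))"
    using p finite_permutations[OF finK] by (subst sum.delta) auto
  also have "(\<Prod>i\<in>?K. ?S i (?p i)) = (\<Prod>v\<in>I. \<Prod>b\<in>(UNIV :: bool set). w v)"
    unfolding prod.cartesian_product by (intro prod.cong) auto
  also have "\<dots> = (\<Prod>v\<in>I. w v)\<^sup>2"
    by (simp add: power2_eq_square prod.distrib)
  also have "of_int (sign ?p) = ((-1) ^ card I :: real)" using p by simp
  finally show ?thesis .
qed

section \<open>Rooted trees\<close>

text \<open>A parent map that fixes the root can be iterated without a side condition, so ancestors
  are just values of its powers. The depth is a rank function that rules out cycles and yields
  induction from the root. Each vertex other than \<open>r\<close> stands for the edge to its
  parent.\<close>

locale rooted_tree =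
  fixes V :: "'a set" and E :: "'a set set" and r :: 'a and par :: "'a \<Rightarrow> 'a" and dep :: "'a \<Rightarrow> nat"
  assumes fin: "finite V" and r_in: "r \<in> V" and par_r: "par r = r"
    and par_in: "\<And>v. v \<in> V \<Longrightarrow> par v \<in> V"
    and dep_par: "\<And>v. v \<in> V \<Longrightarrow> v \<noteq> r \<Longrightarrow> dep v = Suc (dep (par v))"
    and E_eq: "E = (\<lambda>v. {v, par v}) ` (V - {r})"
begin

text \<open>For \<open>u\<close> other than the root this is one side of the edge joining
  \<open>u\<close> to \<open>par u\<close>, so everything about cutting the tree at an edge is
  expressed by these sets.\<close>

definition sub :: "'a \<Rightarrow> 'a set" where
  "sub u = {v \<in> V. \<exists>k. (par ^^ k) v = u}"

lemma sub_subset: "sub u \<subseteq> V"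
  by (auto simp: sub_def)

lemma sub_refl: "u \<in> V \<Longrightarrow> u \<in> sub u"
  by (auto simp: sub_def intro: exI[of _ 0])

lemma sub_step:
  assumes "v \<in> V"
  shows "v \<in> sub u \<longleftrightarrow> v = u \<or> par v \<in> sub u"
proof
  assume "v \<in> sub u"
  then obtain k where "(par ^^ k) v = u" by (auto simp: sub_def)
  then show "v = u \<or> par v \<in> sub u"
    using assms by (cases k) (auto simp: sub_def par_in funpow_swap1)
next
  assume "v = u \<or> par v \<in> sub u"
  then show "v \<in> sub u"
    using assms by (auto simp: sub_def funpow_swap1 intro: exI[of _ "Suc _"] exI[of _ 0])
qed

lemma funpow_par_r: "(par ^^ k) r = r"
  by (induction k) (auto simp: par_r)

lemma r_in_sub: "r \<in> sub u \<longleftrightarrow> u = r"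
  using r_in by (auto simp: sub_def funpow_par_r)

lemma dep_induct [consumes 1, case_names root step]:
  assumes "v \<in> V" and "P r"
    and "\<And>v. v \<in> V \<Longrightarrow> v \<noteq> r \<Longrightarrow> P (par v) \<Longrightarrow> P v"
  shows "P v"
  using assms(1)
proof (induction "dep v" arbitrary: v rule: less_induct)
  case less
  then show ?case
    using assms(2,3) dep_par par_in by (cases "v = r") auto
qed

lemma dep_sub:
  assumes "v \<in> sub u" "u \<noteq> r"
  shows "dep u \<le> dep v" and "dep u = dep v \<Longrightarrow> u = v"
proof -
  have "v \<in> V" using assms by (auto simp: sub_def)
  then have "v \<in> sub u \<longrightarrow> dep u \<le> dep v \<and> (dep u = dep v \<longrightarrow> u = v)"
  proof (induction v rule: dep_induct)
    case root
    then show ?case using assms by (simp add: r_in_sub)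
  next
    case (step v)
    then show ?case using sub_step[of v u] dep_par[of v] by auto
  qed
  then show "dep u \<le> dep v" and "dep u = dep v \<Longrightarrow> u = v" using assms by auto
qed

lemma sub_antisym:
  assumes "v \<in> sub u" "u \<in> sub v"
  shows "u = v"
proof (cases "u = r \<or> v = r")
  case True
  then show ?thesis using assms r_in_sub by auto
next
  case False
  then show ?thesis using dep_sub assms by (metis le_antisym)
qed

lemma par_notin_sub:
  assumes "u \<in> V" "u \<noteq> r"
  shows "par u \<notin> sub u"
  using dep_sub(1)[of "par u" u] dep_par[OF assms] assms by auto

lemma par_neq: "u \<in> V \<Longrightarrow> u \<noteq> r \<Longrightarrow> par u \<noteq> u"
  using dep_par by fastforce

lemma sub_trans:
  assumes "w \<in> sub v" "v \<in> sub u" shows "w \<in> sub u"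
proof -
  obtain k k' where "(par ^^ k) w = v" "(par ^^ k') v = u" using assms by (auto simp: sub_def)
  then have "(par ^^ (k' + k)) w = u" by (simp add: funpow_add)
  then show ?thesis using assms by (auto simp: sub_def)
qed

text \<open>The ancestors of \<open>w\<close> form a chain. Climbing from \<open>w\<close>, one
  either meets \<open>u\<close> or \<open>u'\<close>, or both still lie above the parent.\<close>

lemma sub_nested_or_disjoint:
  assumes "w \<in> sub u" "w \<in> sub u'"
  shows "sub u \<subseteq> sub u' \<or> sub u' \<subseteq> sub u"
proof -
  have "u \<in> sub u' \<or> u' \<in> sub u"
    using subsetD[OF sub_subset assms(1)] assms
  proof (induction w rule: dep_induct)
    case root
    then show ?case by (simp add: r_in_sub)
  next
    case (step v)
    then show ?case using sub_step[of v] by metis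
  qed
  then show ?thesis using sub_trans by blast
qed

lemma in_sub_root: "v \<in> V \<Longrightarrow> v \<in> sub r"
  by (induction v rule: dep_induct) (auto simp: r_in_sub sub_step)

lemma edge_cases:
  assumes "{x, y} \<in> E"
  obtains "x \<in> V" "x \<noteq> r" "y = par x" | "y \<in> V" "y \<noteq> r" "x = par y"
proof -
  obtain v where "v \<in> V" "v \<noteq> r" "{x, y} = {v, par v}" using assms by (auto simp: E_eq)
  then show ?thesis using that by (metis doubleton_eq_iff)
qed

lemma parent_edge: "v \<in> V \<Longrightarrow> v \<noteq> r \<Longrightarrow> {v, par v} \<in> E"
  by (auto simp: E_eq)

lemma edge_in_V: "{x, y} \<in> E \<Longrightarrow> x \<in> V \<and> y \<in> V"
  by (erule edge_cases) (auto simp: par_in)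

lemma parent_edge_inj:
  assumes "u \<in> V" "u \<noteq> r" "v \<in> V" "v \<noteq> r" "{u, par u} = {v, par v}"
  shows "u = v"
  using assms dep_par[of u] dep_par[of v] by (auto simp: doubleton_eq_iff)

section \<open>Distances as numbers of separating edges\<close>

definition separators :: "'a \<Rightarrow> 'a \<Rightarrow> 'a set" where
  "separators x y = {u \<in> V - {r}. (x \<in> sub u) \<noteq> (y \<in> sub u)}"

lemma finite_separators: "finite (separators x y)"
  using fin by (auto simp: separators_def)

lemma separators_sym: "separators x y = separators y x"
  by (auto simp: separators_def)

lemma separators_triangle: "separators x z \<subseteq> separators x y \<union> separators y z"
  by (auto simp: separators_def)

lemma separators_par:
  assumes "x \<in> V" "x \<noteq> r"
  shows "separators x (par x) = {x}"
  using assms sub_step[OF assms(1)] par_notin_sub[OF assms] sub_refl[OF assms(1)]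
  by (auto simp: separators_def)

lemma separators_edge:
  assumes "{x, y} \<in> E"
  shows "card (separators x y) = 1"
  using assms by (rule edge_cases) (auto simp: separators_par separators_sym[of "par _"])

lemma walk_separators:
  assumes "((\<lambda>a b. {a, b} \<in> E) ^^ k) x y"
  shows "card (separators x y) \<le> k"
  using assms
proof (induction k arbitrary: y)
  case 0
  then show ?case by (simp add: separators_def)
next
  case (Suc k)
  then obtain z where z: "card (separators x z) \<le> k" "{z, y} \<in> E" by auto
  have "card (separators x y) \<le> card (separators x z \<union> separators z y)"
    by (intro card_mono separators_triangle) (simp add: finite_separators)
  also have "\<dots> \<le> card (separators x z) + card (separators z y)" by (rule card_Un_le)
  finally show ?case using z separators_edge by fastforce
qed

lemma separators_par_diff:
  assumes "x \<in> V" "x \<noteq> r" "y \<notin> sub x"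
  shows "separators (par x) y = separators x y - {x}" and "x \<in> separators x y"
  using assms sub_step[OF assms(1)] par_notin_sub[OF assms(1,2)] sub_refl[OF assms(1)]
  by (auto simp: separators_def)

text \<open>Of two distinct endpoints, one is not an ancestor of the other; moving that one to its
  parent removes exactly one separator.\<close>

lemma separators_walk:
  assumes "x \<in> V" "y \<in> V"
  shows "((\<lambda>a b. {a, b} \<in> E) ^^ card (separators x y)) x y"
  using assms
proof (induction "card (separators x y)" arbitrary: x y rule: less_induct)
  case less
  let ?R = "\<lambda>a b. {a, b} \<in> E"
  \<comment> \<open>The induction hypothesis is a premise here so that the step can be used for both
    orders of the endpoints.\<close>
  have step: "(?R ^^ card (separators x y)) x y"
    if x: "x \<in> V" "x \<noteq> r" and "y \<in> V" "y \<notin> sub x"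
      and IH: "\<And>x' y'. card (separators x' y') < card (separators x y) \<Longrightarrow> x' \<in> V \<Longrightarrow> y' \<in> V \<Longrightarrow>
        (?R ^^ card (separators x' y')) x' y'"
    for x y
  proof -
    have "Suc (card (separators (par x) y)) = card (separators x y)"
      unfolding separators_par_diff(1)[OF x \<open>y \<notin> sub x\<close>]
      using separators_par_diff(2)[OF x \<open>y \<notin> sub x\<close>] finite_separators card_Suc_Diff1 by metis
    moreover have "(?R ^^ card (separators (par x) y)) (par x) y"
      using calculation \<open>y \<in> V\<close> x by (intro IH) (auto simp: par_in)
    moreover have "?R x (par x)" using parent_edge[OF x] .
    ultimately show ?thesis using relpowp_Suc_I2[of ?R x "par x"] by metis
  qed
  have rev: "(?R ^^ k) a b \<Longrightarrow> (?R ^^ k) b a" for k a b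
  proof (induction k arbitrary: b)
    case (Suc k)
    then obtain z where "(?R ^^ k) a z" "{z, b} \<in> E" by auto
    then have "?R b z" "(?R ^^ k) z a" using Suc.IH by (simp_all add: insert_commute)
    then show ?case by (rule relpowp_Suc_I2)
  qed simp
  consider "x = y" | "x \<noteq> y" "y \<notin> sub x" | "x \<noteq> y" "x \<notin> sub y"
    using sub_antisym by blast
  then show ?case
  proof cases
    case 1
    then show ?thesis by (simp add: separators_def)
  next
    case 2
    then have "x \<noteq> r" using in_sub_root less.prems by auto
    then show ?thesis using step[of x y] less 2 by blast
  next
    case 3
    then have "y \<noteq> r" using in_sub_root less.prems by auto
    have "(?R ^^ card (separators y x)) y x"
      by (rule step) (use less.prems \<open>y \<noteq> r\<close> 3 less.hyps[unfolded separators_sym[of x y]] in blast)+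
    then show ?thesis unfolding separators_sym[of x y] by (rule rev)
  qed
qed

lemma tdist_eq:
  assumes "x \<in> V" "y \<in> V"
  shows "tdist E x y = card (separators x y)"
  unfolding tdist_def
  by (rule Least_equality) (use separators_walk[OF assms] walk_separators in auto)

section \<open>The largest of the three sums, computed edge by edge\<close>

definition splits :: "'a \<Rightarrow> 'a set \<Rightarrow> bool" where
  "splits u P \<longleftrightarrow> \<not> P \<subseteq> sub u \<and> P \<inter> sub u \<noteq> {}"

definition separates :: "'a \<Rightarrow> 'a set \<Rightarrow> 'a set \<Rightarrow> bool" where
  "separates u P Q \<longleftrightarrow> (P \<subseteq> sub u \<and> Q \<inter> sub u = {}) \<or> (Q \<subseteq> sub u \<and> P \<inter> sub u = {})"

text \<open>For a single edge, none of the three pairings contributes more than the summand on the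
  right. It remains to find one pairing that attains this bound at all edges simultaneously.\<close>

lemma max_sums_eq:
  assumes "w \<in> V" "x \<in> V" "y \<in> V" "z \<in> V"
  shows "max (tdist E w x + tdist E y z) (max (tdist E w y + tdist E x z) (tdist E w z + tdist E x y))
    = (\<Sum>u\<in>V - {r}. of_bool (splits u {w, x}) + of_bool (splits u {y, z})
        + 2 * of_bool (separates u {w, x} {y, z}))"
    (is "max ?a (max ?b ?c) = ?m")
proof -
  let ?s = "\<lambda>a b u. of_bool ((a \<in> sub u) \<noteq> (b \<in> sub u)) :: nat"
  let ?t = "\<lambda>u. of_bool (splits u {w, x}) + of_bool (splits u {y, z})
        + 2 * of_bool (separates u {w, x} {y, z}) :: nat"
  have d: "tdist E a b = (\<Sum>u\<in>V - {r}. ?s a b u)" if "a \<in> V" "b \<in> V" for a b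
    using fin by (simp add: tdist_eq[OF that] separators_def Int_def)
  have le: "?s w x u + ?s y z u \<le> ?t u" "?s w y u + ?s x z u \<le> ?t u" "?s w z u + ?s x y u \<le> ?t u" for u
    unfolding splits_def separates_def
    by (cases "w \<in> sub u"; cases "x \<in> sub u"; cases "y \<in> sub u"; cases "z \<in> sub u"; simp)+
  have a: "?a = (\<Sum>u\<in>V - {r}. ?s w x u + ?s y z u)"
    and b: "?b = (\<Sum>u\<in>V - {r}. ?s w y u + ?s x z u)"
    and c: "?c = (\<Sum>u\<in>V - {r}. ?s w z u + ?s x y u)"
    using assms by (simp_all add: d sum.distrib)
  have "?a \<le> ?m" "?b \<le> ?m" "?c \<le> ?m"
    unfolding a b c by (intro sum_mono le)+
  \<comment> \<open>If no edge separates the two pairs, their own lengths attain the bound. If some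
    edge does, a crossing pairing attains it, and \<open>?b\<close> is enough.\<close>
  moreover have "?a = ?m \<or> ?b = ?m"
  proof (cases "\<exists>u\<in>V - {r}. separates u {w, x} {y, z}")
    case False
    have "?s w x u + ?s y z u = ?t u" if "u \<in> V - {r}" for u
      using False that unfolding splits_def by (auto simp: of_bool_def)
    then show ?thesis unfolding a by (intro disjI1 sum.cong refl)
  next
    case True
    then obtain u0 where u0: "separates u0 {w, x} {y, z}" by blast
    have "?s w y u + ?s x z u = ?t u" if "u \<in> V - {r}" for u
    proof (rule ccontr)
      \<comment> \<open>The bound can fail only at an edge with w, y on one side and x, z on the
        other. Such a cut would cross the cut of \<open>u0\<close>, which has w, x on one side, and
        this contradicts the laminarity of the sets \<open>sub u\<close>.\<close>
      assume ne: "?s w y u + ?s x z u \<noteq> ?t u"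
      have "((w \<in> sub u) = (y \<in> sub u)) \<and> ((x \<in> sub u) = (z \<in> sub u)) \<and> ((w \<in> sub u) \<noteq> (x \<in> sub u))"
        using ne unfolding splits_def separates_def
        by (cases "w \<in> sub u"; cases "x \<in> sub u"; cases "y \<in> sub u"; cases "z \<in> sub u") simp_all
      then show False
        using u0 sub_nested_or_disjoint[of _ u u0] unfolding separates_def by blast
    qed
    then show ?thesis unfolding b by (intro disjI2 sum.cong refl)
  qed
  ultimately show ?thesis by linarith
qed

text \<open>These are the vertices with a child. The root is left out because it is a leaf in the
  application, so that this becomes the set of all vertices that are not leaves.\<close>

definition internal :: "'a set" where
  "internal = par ` (V - {r}) - {r}"

lemma internal_subset: "internal \<subseteq> V - {r}"
  by (auto simp: internal_def par_in)

lemma finite_internal: "finite internal"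
  using finite_subset[OF internal_subset] fin by simp

lemma par_internal: "v \<in> V \<Longrightarrow> v \<noteq> r \<Longrightarrow> par v \<noteq> r \<Longrightarrow> par v \<in> internal"
  by (auto simp: internal_def)

lemma internal_child:
  assumes "v \<in> internal"
  obtains c where "c \<in> V" "c \<noteq> r" "par c = v"
  using assms by (auto simp: internal_def)

lemma sub_leaf:
  assumes "u \<in> V - {r}" "u \<notin> internal"
  shows "sub u = {u}"
proof -
  have "v = u" if "v \<in> sub u" for v
  proof (rule ccontr)
    assume "v \<noteq> u"
    have "v \<in> V" using that sub_subset by auto
    then show False using that \<open>v \<noteq> u\<close>
    proof (induction v rule: dep_induct)
      case root
      then show ?case using assms r_in_sub by auto
    next
      case (step v)
      then have "par v \<in> sub u" "par v \<noteq> u"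
        using sub_step[of v u] assms par_internal[of v] by auto
      then show ?case using step by blast
    qed
  qed
  then show ?thesis using assms sub_refl by auto
qed

lemma star_of_nonroot:
  assumes "v \<in> V" "v \<noteq> r"
  shows "{e \<in> E. v \<in> e} = insert {v, par v} ((\<lambda>c. {c, v}) ` {c \<in> V - {r}. par c = v})"
  using assms by (auto simp: E_eq)

lemma tdeg_nonroot:
  assumes "v \<in> V" "v \<noteq> r"
  shows "tdeg E v = 1 \<longleftrightarrow> v \<notin> internal"
proof
  assume "tdeg E v = 1"
  then obtain e where e: "{e \<in> E. v \<in> e} = {e}" unfolding tdeg_def by (rule card_1_singletonE)
  show "v \<notin> internal"
  proof
    assume "v \<in> internal"
    then obtain c where c: "c \<in> V" "c \<noteq> r" "par c = v" by (rule internal_child)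
    have "{c, v} = {v, par v}" using e star_of_nonroot[OF assms] c by auto
    then have "c = v \<or> c = par v" by auto
    then show False using dep_par[of c] dep_par[of v] assms c by auto
  qed
next
  assume "v \<notin> internal"
  then have "{c \<in> V - {r}. par c = v} = {}" using assms by (auto simp: internal_def)
  then show "tdeg E v = 1" unfolding tdeg_def star_of_nonroot[OF assms] by (simp only:) simp
qed

end

lemma reach_imp_relpowp:
  assumes "graph_reach V E x y"
  shows "\<exists>k. ((\<lambda>a b. {a, b} \<in> E) ^^ k) x y"
proof -
  have "(\<lambda>a b. {a, b} \<in> E)\<^sup>*\<^sup>* x y"
    using assms unfolding graph_reach_def by (rule rtranclp_mono[THEN predicate2D, rotated]) auto
  then show ?thesis by (rule rtranclp_imp_relpowp)
qed

text \<open>Depth is the distance from \<open>r\<close>. By depth, different vertices have different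
  parent edges, and since there are \<open>card V - 1\<close> edges in all, every edge is a parent
  edge. Acyclicity thus comes from counting.\<close>

lemma tree_rooted:
  assumes tree: "is_tree V E" and r: "r \<in> V"
  obtains par dep where "rooted_tree V E r par dep"
proof -
  let ?R = "\<lambda>a b. {a, b} \<in> E"
  define dep where "dep = tdist E r"
  have fin: "finite V" and gr: "is_graph V E" and conn: "graph_connected V E"
    and cardE: "card E = card V - 1" using tree by (auto simp: is_tree_def)
  have dep_le: "(?R ^^ k) r v \<Longrightarrow> dep v \<le> k" for k v
    unfolding dep_def tdist_def by (rule Least_le)
  have dep_walk: "(?R ^^ dep v) r v" if "v \<in> V" for v
    unfolding dep_def tdist_def
    by (rule LeastI_ex, rule reach_imp_relpowp[of V]) (use conn that r in \<open>auto simp: graph_connected_def\<close>)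
  \<comment> \<open>The neighbour is the last vertex but one on a shortest walk from
    \<open>r\<close>.\<close>
  have ex: "\<exists>u. {v, u} \<in> E \<and> dep v = Suc (dep u)" if v: "v \<in> V" "v \<noteq> r" for v
  proof (cases "dep v")
    case 0
    then show ?thesis using dep_walk[OF v(1)] v by simp
  next
    case (Suc m)
    then obtain u where u: "(?R ^^ m) r u" "{u, v} \<in> E" using dep_walk[OF v(1)] by auto
    have "u \<in> V" using u gr by (auto simp: is_graph_def)
    have "(?R ^^ Suc (dep u)) r v" using dep_walk[OF \<open>u \<in> V\<close>] u by auto
    then have "dep v \<le> Suc (dep u)" by (rule dep_le)
    moreover have "dep u \<le> m" using u by (intro dep_le)
    ultimately show ?thesis using u Suc by (auto simp: insert_commute)
  qed
  define par where "par = (\<lambda>v. if v \<in> V - {r} then SOME u. {v, u} \<in> E \<and> dep v = Suc (dep u) else r)"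
  have par: "{v, par v} \<in> E" "dep v = Suc (dep (par v))" if "v \<in> V" "v \<noteq> r" for v
    using someI_ex[OF ex[OF that]] that by (auto simp: par_def)
  have "inj_on (\<lambda>v. {v, par v}) (V - {r})"
  proof (rule inj_onI)
    fix u v assume uv: "u \<in> V - {r}" "v \<in> V - {r}" "{u, par u} = {v, par v}"
    then have "u = v \<or> u = par v \<and> par u = v" by (auto simp: doubleton_eq_iff)
    then show "u = v" using par(2)[of u] par(2)[of v] uv by auto
  qed
  then have "card ((\<lambda>v. {v, par v}) ` (V - {r})) = card E"
    using cardE r fin by (simp add: card_image)
  moreover have "finite E"
    using fin gr by (intro finite_subset[of E "Pow V"]) (auto simp: is_graph_def)
  ultimately have "(\<lambda>v. {v, par v}) ` (V - {r}) = E"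
    using par by (intro card_subset_eq) auto
  moreover have "par r = r" by (simp add: par_def)
  moreover have "par v \<in> V" if "v \<in> V" for v
  proof (cases "v = r")
    case False
    then have "{v, par v} \<subseteq> V" using par(1)[OF that] gr unfolding is_graph_def by blast
    then show ?thesis by simp
  qed (simp add: \<open>par r = r\<close> r)
  ultimately have "rooted_tree V E r par dep"
    using fin r par(2) by unfold_locales auto
  then show ?thesis by (rule that)
qed

section \<open>The algorithm on the line graph\<close>

lemma reach_refl: "graph_reach W F x x"
  by (simp add: graph_reach_def)

lemma reach_edge: "{x, y} \<in> F \<Longrightarrow> x \<noteq> y \<Longrightarrow> x \<in> W \<Longrightarrow> y \<in> W \<Longrightarrow> graph_reach W F x y"
  unfolding graph_reach_def by (rule r_into_rtranclp) simp

lemma reach_trans: "graph_reach W F x y \<Longrightarrow> graph_reach W F y z \<Longrightarrow> graph_reach W F x z"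
  unfolding graph_reach_def by (rule rtranclp_trans)

lemma reach_sym: "graph_reach W F x y \<Longrightarrow> graph_reach W F y x"
  unfolding graph_reach_def
  by (rule sympD[OF symp_rtranclp]) (auto intro!: sympI simp: insert_commute)

lemma reach_cong: "graph_reach W F a b \<Longrightarrow> graph_reach W F a = graph_reach W F b"
  by (intro ext) (metis reach_trans reach_sym)

lemma reach_induct [consumes 1, case_names refl step]:
  assumes "graph_reach W F x y" and "P x"
    and "\<And>y z. graph_reach W F x y \<Longrightarrow> P y \<Longrightarrow> {y, z} \<in> F \<Longrightarrow> y \<noteq> z \<Longrightarrow> y \<in> W \<Longrightarrow> z \<in> W \<Longrightarrow> P z"
  shows "P y"
  using assms(1) unfolding graph_reach_def
  by (induction rule: rtranclp_induct) (use assms(2,3) in \<open>auto simp: graph_reach_def\<close>)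

lemma reach_mono:
  assumes "graph_reach W F x y" "W \<subseteq> W'" "F \<subseteq> F'"
  shows "graph_reach W' F' x y"
  using assms(1)
proof (induction rule: reach_induct)
  case (step y z)
  then show ?case using assms reach_trans[OF step.IH reach_edge[of y z]] by blast
qed (rule reach_refl)

lemma reach_avoid:
  assumes "graph_reach W F x z" "\<not> graph_reach W F x e"
  shows "graph_reach (W - {e}) {f \<in> F. f \<inter> {e} = {}} x z"
  using assms(1)
proof (induction rule: reach_induct)
  case (step y z)
  have "graph_reach W F x z" using step reach_trans[OF step.hyps(1) reach_edge] by blast
  then have "y \<noteq> e" "z \<noteq> e" using assms(2) step by auto
  then show ?case using step by (intro reach_trans[OF step.IH reach_edge]) auto
qed (rule reach_refl)

lemma card_image_less:
  assumes "finite A" "\<not> inj_on g A"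
  shows "card (g ` A) < card A"
  using card_image_le[OF assms(1), of g] eq_card_imp_inj_on[OF assms(1), of g] assms(2) by linarith

text \<open>Send each component left after deleting \<open>e\<close> to the old component containing
  it. This map is onto, and it identifies the components of \<open>x\<close> and \<open>y\<close>,
  so the number of components has grown.\<close>

lemma cut_vertexI:
  assumes fin: "finite W" and e: "e \<in> W"
    and x: "x \<in> W - {e}" and y: "y \<in> W - {e}" and xy: "graph_reach W F x y"
    and nxy: "\<not> graph_reach (W - {e}) {f \<in> F. f \<inter> {e} = {}} x y"
  shows "cut_vertex W F e"
proof -
  let ?F = "{f \<in> F. f \<inter> {e} = {}}"
  let ?C = "\<lambda>x. {y \<in> W. graph_reach W F x y}"
  let ?C' = "\<lambda>x. {y \<in> W - {e}. graph_reach (W - {e}) ?F x y}"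
  let ?g = "\<lambda>K. \<Union>z\<in>K. ?C z"
  have xe: "graph_reach W F x e" using reach_avoid[OF xy] nxy by blast
  have C_eq: "?C a = ?C b" if "graph_reach W F a b" for a b
    using reach_cong[OF that] by simp
  have g: "?g (?C' a) = ?C a" if "a \<in> W - {e}" for a
  proof -
    have "?C z = ?C a" if "z \<in> ?C' a" for z
      by (rule C_eq[OF reach_sym], rule reach_mono[of "W - {e}" ?F]) (use that in auto)
    moreover have "a \<in> ?C' a" using that reach_refl by auto
    ultimately show ?thesis by blast
  qed
  \<comment> \<open>No old component is lost when \<open>e\<close> is dropped, because that of
    \<open>e\<close> also contains \<open>x\<close>.\<close>
  have "?C ` W = ?C ` (W - {e})"
    using C_eq[OF xe] x e by auto
  also have "\<dots> = ?g ` ?C' ` (W - {e})"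
    using g by (auto simp: image_image)
  finally have "?C ` W = ?g ` ?C' ` (W - {e})" .
  moreover have "\<not> inj_on ?g (?C' ` (W - {e}))"
  proof
    assume "inj_on ?g (?C' ` (W - {e}))"
    moreover have "?g (?C' x) = ?g (?C' y)" using g[OF x] g[OF y] C_eq[OF xy] by simp
    ultimately have "?C' x = ?C' y" using imageI[OF x, of ?C'] imageI[OF y, of ?C'] by (rule inj_onD)
    moreover have "y \<in> ?C' y" using y by (simp add: reach_refl)
    ultimately have "y \<in> ?C' x" by simp
    then show False using nxy by simp
  qed
  moreover have "finite (?C' ` (W - {e}))" using fin by simp
  ultimately have "card (?C ` W) < card (?C' ` (W - {e}))"
    using card_image_less[of "?C' ` (W - {e})" ?g] by simp
  then show ?thesis
    using e unfolding cut_vertex_def num_comps_def del_verts_def by simp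
qed

text \<open>The neighbours of \<open>e\<close> are pairwise adjacent, so every walk through
  \<open>e\<close> can be shortcut. The map from new components to old ones is therefore
  injective.\<close>

lemma simplicial_not_cut_vertex:
  assumes fin: "finite W"
    and nb: "\<And>a b. {a, e} \<in> F \<Longrightarrow> {e, b} \<in> F \<Longrightarrow> a \<noteq> e \<Longrightarrow> b \<noteq> e \<Longrightarrow> a \<noteq> b \<Longrightarrow>
      a \<in> W \<Longrightarrow> b \<in> W \<Longrightarrow> {a, b} \<in> F"
  shows "\<not> cut_vertex W F e"
proof -
  let ?F = "{f \<in> F. f \<inter> {e} = {}}"
  let ?C = "\<lambda>x. {y \<in> W. graph_reach W F x y}"
  let ?C' = "\<lambda>x. {y \<in> W - {e}. graph_reach (W - {e}) ?F x y}"
  \<comment> \<open>While the walk stands at \<open>e\<close>, the invariant keeps a neighbour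
    \<open>a\<close> of \<open>e\<close> already reached without \<open>e\<close>, from which the
    shortcut starts.\<close>
  have short: "if z = e then \<exists>a. {a, e} \<in> F \<and> a \<noteq> e \<and> a \<in> W \<and> graph_reach (W - {e}) ?F x a
      else graph_reach (W - {e}) ?F x z"
    if "graph_reach W F x z" "x \<noteq> e" for x z
    using that(1)
  proof (induction rule: reach_induct)
    case refl
    then show ?case using that(2) by (simp add: reach_refl)
  next
    case (step y z)
    consider "z = e" | "z \<noteq> e" "y = e" | "z \<noteq> e" "y \<noteq> e" by blast
    then show ?case
    proof cases
      case 1
      then show ?thesis using step by auto
    next
      case 2
      then obtain a where a: "{a, e} \<in> F" "a \<noteq> e" "a \<in> W" "graph_reach (W - {e}) ?F x a"
        using step.IH by auto
      show ?thesis
      proof (cases "a = z")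
        case False
        have "{e, z} \<in> F" "z \<in> W" using 2 step.hyps by simp_all
        then have "{a, z} \<in> F" by (intro nb[OF a(1) _ a(2) 2(1) False a(3)])
        then have "graph_reach (W - {e}) ?F a z" using a 2 \<open>z \<in> W\<close> False by (intro reach_edge) auto
        then show ?thesis using a(4) 2 reach_trans by fastforce
      next
        case True
        then show ?thesis using a 2 by simp
      qed
    next
      case 3
      then have "graph_reach (W - {e}) ?F y z" using step by (intro reach_edge) auto
      then show ?thesis using 3 step.IH reach_trans by fastforce
    qed
  qed
  have "card (?C' ` (W - {e})) \<le> card (?C ` W)"
  proof (rule card_inj_on_le)
    show "finite (?C ` W)" using fin by simp
    let ?g = "\<lambda>K. \<Union>z\<in>K. ?C z"
    have g: "?g (?C' a) = ?C a" if "a \<in> W - {e}" for a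
    proof -
      have "?C z = ?C a" if "z \<in> ?C' a" for z
      proof -
        have "graph_reach W F a z" by (rule reach_mono[of "W - {e}" ?F]) (use that in auto)
        from reach_cong[OF this] show ?thesis by (simp only:)
      qed
      moreover have "a \<in> ?C' a" using that reach_refl by auto
      ultimately show ?thesis by blast
    qed
    show "?g ` ?C' ` (W - {e}) \<subseteq> ?C ` W" using g by (auto simp: image_image)
    show "inj_on ?g (?C' ` (W - {e}))"
    proof (rule inj_onI)
      fix K L assume "K \<in> ?C' ` (W - {e})" "L \<in> ?C' ` (W - {e})" and eq: "?g K = ?g L"
      then obtain a b where ab: "a \<in> W - {e}" "b \<in> W - {e}" "K = ?C' a" "L = ?C' b" by blast
      have "?C a = ?C b" using eq unfolding ab(3,4) g[OF ab(1)] g[OF ab(2)] .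
      moreover have "b \<in> ?C b" using ab(2) by (simp add: reach_refl)
      ultimately have "b \<in> ?C a" by (simp only:)
      then have "graph_reach W F a b" by simp
      then have "graph_reach (W - {e}) ?F a b" using short[of a b] ab(1,2) by simp
      from reach_cong[OF this] show "K = L" unfolding ab(3,4) by (simp only:)
    qed
  qed
  then show ?thesis
    unfolding cut_vertex_def num_comps_def del_verts_def by simp
qed

section \<open>Blocks and cut vertices of the partially processed line graph\<close>

context rooted_tree
begin

definition star :: "'a \<Rightarrow> 'a set set" where
  "star v = {e \<in> E. v \<in> e}"

definition clique :: "'a \<Rightarrow> 'a set set set" where
  "clique v = {{e, f} | e f. e \<in> star v \<and> f \<in> star v \<and> e \<noteq> f}"

text \<open>The graph to which the line graph has been reduced when the blocks of exactly the internal
  vertices in \<open>R\<close> are still unprocessed.\<close>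

definition rest_verts :: "'a set \<Rightarrow> 'a set set" where
  "rest_verts R = {e \<in> E. e \<inter> R \<noteq> {}}"

definition rest_edges :: "'a set \<Rightarrow> 'a set set set" where
  "rest_edges R = {{e, f} | e f. e \<in> E \<and> f \<in> E \<and> e \<noteq> f \<and> e \<inter> f \<inter> R \<noteq> {}}"

lemma rest_edges_iff:
  "{e, f} \<in> rest_edges R \<longleftrightarrow> e \<in> E \<and> f \<in> E \<and> e \<noteq> f \<and> e \<inter> f \<inter> R \<noteq> {}"
  unfolding rest_edges_def by (auto simp: doubleton_eq_iff)

lemma clique_iff: "{e, f} \<in> clique v \<longleftrightarrow> e \<in> star v \<and> f \<in> star v \<and> e \<noteq> f"
  unfolding clique_def by (auto simp: doubleton_eq_iff)

lemma edgeE: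
  assumes "e \<in> E"
  obtains w where "w \<in> V" "w \<noteq> r" "e = {w, par w}"
  using assms by (auto simp: E_eq)

lemma edge_eqI:
  assumes "e \<in> E" "x \<in> e" "y \<in> e" "x \<noteq> y"
  shows "e = {x, y}"
  using assms by (auto simp: E_eq)

lemma finite_E: "finite E"
  using fin by (simp add: E_eq)

lemma star_cases:
  assumes "e \<in> star v"
  obtains "e = {v, par v}" | c where "c \<in> V" "c \<noteq> r" "par c = v" "e = {v, c}"
proof -
  have "e \<in> E" "v \<in> e" using assms by (auto simp: star_def)
  then obtain w where "w \<in> V" "w \<noteq> r" "e = {w, par w}" "v = w \<or> v = par w" by (auto elim: edgeE)
  then show ?thesis using that by (auto simp: insert_commute)
qed

text \<open>Inside the rest graph the edges below \<open>c\<close> are only connected to the others through the edge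
  joining \<open>c\<close> to its parent.\<close>

lemma below_closed:
  assumes c: "c \<in> V" "c \<noteq> r" and g: "g \<in> E" "g \<subseteq> sub c"
    and adj: "{g, h} \<in> rest_edges R" and h: "h \<noteq> {c, par c}"
  shows "h \<subseteq> sub c"
proof -
  obtain x where x: "x \<in> g" "x \<in> h" and hE: "h \<in> E" using adj by (auto simp: rest_edges_iff)
  obtain w where w: "w \<in> V" "w \<noteq> r" "h = {w, par w}" using hE by (rule edgeE)
  have "w \<in> sub c" using x g w sub_step[of w c] by auto
  moreover have "w \<noteq> c" using h w by auto
  ultimately show ?thesis using w sub_step[of w c] by auto
qed

text \<open>The only passage from the edges meeting \<open>sub v\<close> to other edges is the
  common endpoint \<open>par v\<close>, and adjacency through \<open>par v\<close> has disappeared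
  with \<open>par v\<close> from \<open>R\<close>.\<close>

lemma meets_sub_closed:
  assumes v: "v \<in> V" "v \<noteq> r" "par v \<notin> R" and g: "g \<in> E" "g \<inter> sub v \<noteq> {}"
    and adj: "{g, h} \<in> rest_edges R"
  shows "h \<inter> sub v \<noteq> {}"
proof -
  obtain x where x: "x \<in> g" "x \<in> h" "x \<in> R" using adj by (auto simp: rest_edges_iff)
  obtain w where w: "w \<in> V" "w \<noteq> r" "g = {w, par w}" using g(1) by (rule edgeE)
  have "w \<in> sub v" using g w sub_step[of w v] by auto
  then have "x \<in> sub v" using x w sub_step[of w v] v by auto
  then show ?thesis using x by auto
qed

text \<open>Without \<open>{c, par c}\<close>, the edges below \<open>c\<close> are closed under
  adjacency. A general subgraph \<open>(W, F)\<close> is allowed because the lemma is applied both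
  to the whole reduced graph and to a hypothetical larger block.\<close>

lemma par_edge_cut_vertex:
  assumes W: "W \<subseteq> E" and F: "F \<subseteq> rest_edges R"
    and c: "c \<in> V" "c \<noteq> r" "{c, par c} \<in> W"
    and g: "g \<in> W" "g \<subseteq> sub c" and h: "h \<in> W" "h \<noteq> {c, par c}" "\<not> h \<subseteq> sub c"
    and gh: "graph_reach W F g h"
  shows "cut_vertex W F {c, par c}"
proof (rule cut_vertexI[OF _ c(3) _ _ gh])
  show "finite W" using W finite_E finite_subset by blast
  show "g \<in> W - {{c, par c}}" using g par_notin_sub[OF c(1,2)] by auto
  show "h \<in> W - {{c, par c}}" using h by auto
  let ?e = "{c, par c}"
  show "\<not> graph_reach (W - {?e}) {f \<in> F. f \<inter> {?e} = {}} g h"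
  proof
    assume "graph_reach (W - {?e}) {f \<in> F. f \<inter> {?e} = {}} g h"
    then have "h \<subseteq> sub c"
    proof (induction rule: reach_induct)
      case refl
      then show ?case by (rule g)
    next
      case (step y z)
      have "y \<in> E" "{y, z} \<in> rest_edges R" "z \<noteq> {c, par c}" using step.hyps W F by blast+
      then show ?case using below_closed[OF c(1,2) _ step.IH] by blast
    qed
    then show False using h by simp
  qed
qed

lemma nonsep_clique:
  assumes "star v \<noteq> {}" shows "nonsep (star v, clique v)"
proof -
  have "graph_reach (star v) (clique v) x y" if "x \<in> star v" "y \<in> star v" for x y
    using that by (cases "x = y") (auto simp: reach_refl clique_iff intro: reach_edge)
  moreover have "\<not> cut_vertex (star v) (clique v) e" for e
  proof (rule simplicial_not_cut_vertex)
    show "finite (star v)" using finite_E by (simp add: star_def)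
  qed (auto simp: clique_iff)
  ultimately show ?thesis using assms by (simp add: nonsep_def graph_connected_def)
qed

text \<open>Let a nonseparable subgraph contain the star. By \<open>par v \<notin> R\<close> all its
  vertices meet \<open>sub v\<close>. One that avoids \<open>v\<close> lies below a child
  \<open>c\<close> of \<open>v\<close>, and then \<open>{c, v}\<close> separates it from
  \<open>{v, par v}\<close>, so it would be a cut vertex.\<close>

lemma star_is_block:
  assumes R: "R \<subseteq> internal" and v: "v \<in> R" "par v \<notin> R"
  shows "is_block (rest_verts R, rest_edges R) (star v, clique v)"
proof -
  have vV: "v \<in> V" "v \<noteq> r" using R v internal_subset by auto
  have sE: "{v, par v} \<in> star v" using parent_edge[OF vV] by (simp add: star_def)
  have "subgraph (star v, clique v) (rest_verts R, rest_edges R)"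
    using v unfolding subgraph_def star_def clique_def rest_verts_def rest_edges_def by fastforce
  moreover have "nonsep (star v, clique v)" using nonsep_clique sE by blast
  moreover have "H = (star v, clique v)"
    if H: "subgraph H (rest_verts R, rest_edges R)" "nonsep H" "subgraph (star v, clique v) H" for H
  proof -
    obtain W F where HWF: "H = (W, F)" by (cases H)
    have W: "star v \<subseteq> W" "W \<subseteq> rest_verts R" and F: "clique v \<subseteq> F" "F \<subseteq> rest_edges R"
      and FW: "\<And>e. e \<in> F \<Longrightarrow> e \<subseteq> W"
      using H(1,3) unfolding subgraph_def HWF by auto
    have WE: "W \<subseteq> E" using W by (auto simp: rest_verts_def)
    have conn: "graph_reach W F x y" if "x \<in> W" "y \<in> W" for x y
      using H(2) that unfolding HWF nonsep_def graph_connected_def by simp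
    have nocut: "\<not> cut_vertex W F e" for e using H(2) unfolding HWF nonsep_def by simp
    have "W \<subseteq> star v"
    proof
      fix f assume f: "f \<in> W"
      have "graph_reach W F {v, par v} f" using conn f sE W by blast
      then have "f \<inter> sub v \<noteq> {}"
      proof (induction rule: reach_induct)
        case refl
        then show ?case using sub_refl vV by auto
      next
        case (step y z)
        then show ?case using F WE by (intro meets_sub_closed[OF vV v(2) _ step.IH]) auto
      qed
      moreover obtain w where w: "w \<in> V" "w \<noteq> r" "f = {w, par w}" using f WE by (blast elim: edgeE)
      ultimately have "w \<in> sub v" using sub_step[of w v] by auto
      show "f \<in> star v"
      proof (rule ccontr)
        assume nf: "f \<notin> star v"
        then have "w \<noteq> v" "par w \<noteq> v" using w f WE by (auto simp: star_def)
        then have "par w \<in> sub v" using \<open>w \<in> sub v\<close> sub_step[of w v] w by auto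
        \<comment> \<open>The child of \<open>v\<close> through which the path from \<open>u\<close>
          climbs to \<open>v\<close>.\<close>
        have "\<exists>c. c \<in> V \<and> c \<noteq> r \<and> par c = v \<and> u \<in> sub c" if "u \<in> sub v" "u \<noteq> v" for u
        proof -
          have "u \<in> V" using that sub_subset by auto
          then show ?thesis using that
          proof (induction u rule: dep_induct)
            case root
            then show ?case using r_in_sub by auto
          next
            case (step u)
            show ?case
            proof (cases "par u = v")
              case True
              then show ?thesis using step sub_refl by blast
            next
              case False
              then have "par u \<in> sub v" using step sub_step by blast
              then show ?thesis using step False sub_step[of u] by blast
            qed
          qed
        qed
        from this[OF \<open>par w \<in> sub v\<close> \<open>par w \<noteq> v\<close>] obtain c
          where c: "c \<in> V" "c \<noteq> r" "par c = v" "par w \<in> sub c" by blast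
        have "cut_vertex W F {c, par c}"
        proof (rule par_edge_cut_vertex[OF WE F(2) c(1,2)])
          have "{c, par c} \<in> star v" using parent_edge[OF c(1,2)] c(3) by (simp add: star_def)
          then show "{c, par c} \<in> W" using W by auto
          show "f \<in> W" by (rule f)
          show "f \<subseteq> sub c" using w c sub_step[of w c] by auto
          show "{v, par v} \<in> W" using sE W by auto
          have "v \<notin> sub c" using par_notin_sub[OF c(1,2)] c(3) by simp
          then show "\<not> {v, par v} \<subseteq> sub c" by simp
          show "{v, par v} \<noteq> {c, par c}"
            using parent_edge_inj[OF vV c(1,2)] par_neq[OF c(1,2)] c(3) by auto
          show "graph_reach W F f {v, par v}" using conn f sE W by blast
        qed
        then show False using nocut by blast
      qed
    qed
    then have "W = star v" using W by auto
    moreover have "F \<subseteq> clique v"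
    proof
      fix h assume h: "h \<in> F"
      then obtain e f where "h = {e, f}" "e \<noteq> f" using F(2) unfolding rest_edges_def by blast
      then show "h \<in> clique v" using FW[OF h] \<open>W = star v\<close> by (simp add: clique_iff)
    qed
    ultimately show ?thesis using F HWF by auto
  qed
  ultimately show ?thesis unfolding is_block_def by blast
qed

text \<open>If \<open>f\<close> meets \<open>R\<close> only in \<open>v\<close>, all its neighbours
  contain \<open>v\<close> and are pairwise adjacent. Otherwise its other end is an internal child
  \<open>c\<close> of \<open>v\<close>, and \<open>f\<close> separates an edge below
  \<open>c\<close> from the parent edge of \<open>v\<close>.\<close>

lemma star_cut_vertex_iff:
  assumes R: "R \<subseteq> internal" and v: "v \<in> R" "par v \<notin> R" and f: "f \<in> star v"
  shows "cut_vertex (rest_verts R) (rest_edges R) f \<longleftrightarrow> f \<inter> (R - {v}) \<noteq> {}"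
proof
  assume cut: "cut_vertex (rest_verts R) (rest_edges R) f"
  show "f \<inter> (R - {v}) \<noteq> {}"
  proof
    assume no: "f \<inter> (R - {v}) = {}"
    have "\<not> cut_vertex (rest_verts R) (rest_edges R) f"
    proof (rule simplicial_not_cut_vertex)
      show "finite (rest_verts R)" using finite_E by (simp add: rest_verts_def)
      fix a b assume "{a, f} \<in> rest_edges R" "{f, b} \<in> rest_edges R" "a \<noteq> b"
      then show "{a, b} \<in> rest_edges R" using no by (auto simp: rest_edges_iff)
    qed
    then show False using cut by simp
  qed
next
  assume "f \<inter> (R - {v}) \<noteq> {}"
  then obtain c where cR: "c \<in> f" "c \<in> R" "c \<noteq> v" by auto
  have vV: "v \<in> V" "v \<noteq> r" using R v internal_subset by auto
  have f_eq: "f = {v, c}" using f cR by (intro edge_eqI) (auto simp: star_def)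
  have c: "c \<in> V" "c \<noteq> r" using R cR internal_subset by auto
  have parc: "par c = v" using f
    by (rule star_cases) (use f_eq cR v in \<open>auto simp: doubleton_eq_iff\<close>)
  obtain d where d: "d \<in> V" "d \<noteq> r" "par d = c" using R cR by (blast elim: internal_child)
  have fE: "{c, par c} \<in> E" and sE: "{v, par v} \<in> E" and dE: "{d, par d} \<in> E"
    using parent_edge c d vV by blast+
  have ne1: "{v, par v} \<noteq> {c, par c}"
    using parent_edge_inj[OF vV c] cR by auto
  have ne2: "{d, par d} \<noteq> {c, par c}"
    using parent_edge_inj[OF d(1,2) c] d par_neq by blast
  have "cut_vertex (rest_verts R) (rest_edges R) {c, par c}"
  proof (rule par_edge_cut_vertex[of _ _ R])
    show "{c, par c} \<in> rest_verts R" "{d, par d} \<in> rest_verts R" "{v, par v} \<in> rest_verts R"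
      using fE sE dE d cR v by (auto simp: rest_verts_def)
    show "{d, par d} \<subseteq> sub c" using d c sub_refl sub_step[of d c] by auto
    have "v \<notin> sub c" using par_notin_sub[OF c] parc by simp
    then show "\<not> {v, par v} \<subseteq> sub c" by simp
    have "graph_reach (rest_verts R) (rest_edges R) {d, par d} {c, par c}"
      using fE dE ne2 d cR by (intro reach_edge) (auto simp: rest_edges_iff rest_verts_def)
    moreover have "graph_reach (rest_verts R) (rest_edges R) {c, par c} {v, par v}"
      using fE sE ne1 parc v by (intro reach_edge) (auto simp: rest_edges_iff rest_verts_def)
    ultimately show "graph_reach (rest_verts R) (rest_edges R) {d, par d} {v, par v}"
      by (rule reach_trans)
  qed (use c ne1 in \<open>auto simp: rest_verts_def\<close>)
  then show "cut_vertex (rest_verts R) (rest_edges R) f" using f_eq parc by (simp add: insert_commute)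
qed

text \<open>Two distinct tree edges share at most one vertex, so the clique at \<open>v\<close>
  consists exactly of the adjacencies through \<open>v\<close>. The deleted vertices have no other
  adjacencies, hence nothing else is lost.\<close>

lemma rest_remove:
  assumes v: "v \<in> R" "par v \<notin> R"
  shows "del_verts (rest_verts R) (rest_edges R - clique v) {f \<in> star v. f \<inter> (R - {v}) = {}}
    = (rest_verts (R - {v}), rest_edges (R - {v}))"
proof -
  let ?X = "{f \<in> star v. f \<inter> (R - {v}) = {}}"
  have "rest_verts R - ?X = rest_verts (R - {v})"
    using v by (auto simp: rest_verts_def star_def)
  moreover have "{h \<in> rest_edges R - clique v. h \<inter> ?X = {}} = rest_edges (R - {v})"
  proof (intro equalityI subsetI)
    fix h assume h: "h \<in> {h \<in> rest_edges R - clique v. h \<inter> ?X = {}}"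
    then obtain e f where ef: "h = {e, f}" "e \<in> E" "f \<in> E" "e \<noteq> f" "e \<inter> f \<inter> R \<noteq> {}"
      by (auto simp: rest_edges_def)
    have "\<not> (v \<in> e \<and> v \<in> f)" using h ef by (auto simp: clique_iff star_def)
    then show "h \<in> rest_edges (R - {v})" unfolding ef(1) rest_edges_iff using ef by auto
  next
    fix h assume "h \<in> rest_edges (R - {v})"
    then obtain e f x where ef: "h = {e, f}" "e \<in> E" "f \<in> E" "e \<noteq> f" and x: "x \<in> e" "x \<in> f" "x \<in> R - {v}"
      unfolding rest_edges_def by blast
    have "\<not> (v \<in> e \<and> v \<in> f)" using ef x edge_eqI[of e x v] edge_eqI[of f x v] by auto
    then show "h \<in> {h \<in> rest_edges R - clique v. h \<inter> ?X = {}}"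
      using ef x unfolding ef(1) by (auto simp: rest_edges_iff clique_iff star_def)
  qed
  ultimately show ?thesis by (simp add: del_verts_def)
qed

text \<open>Records a run of the algorithm: \<open>ch u\<close> is the lower end of the edge chosen
  in the block at \<open>u\<close>. An internal child gives that block a cut vertex, and a cut
  vertex must then be chosen.\<close>

definition child_choice :: "'a set \<Rightarrow> ('a \<Rightarrow> 'a) \<Rightarrow> bool" where
  "child_choice R ch \<longleftrightarrow> (\<forall>u\<in>R. ch u \<in> V \<and> ch u \<noteq> r \<and> par (ch u) = u \<and>
     ((\<exists>c\<in>internal. par c = u) \<longrightarrow> ch u \<in> internal))"

text \<open>The first case is the symmetric difference of \<open>{u, par u}\<close> and
  \<open>{u, ch u}\<close> from Step 2, the second is the edge chosen in Step 3.\<close>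

definition second_pair :: "('a \<Rightarrow> 'a) \<Rightarrow> 'a \<Rightarrow> 'a set" where
  "second_pair ch u = (if ch u \<in> internal then {par u, ch u} else {u, ch u})"

text \<open>The loop invariant. With \<open>R\<close> closed under internal children, the remaining
  graph falls apart into pieces, each entered through the parent edge of its top vertex;
  \<open>v\<close> is the current top and \<open>N\<close> holds the entrances to the
  others.\<close>

definition state :: "'a set \<Rightarrow> 'a \<Rightarrow> 'a set set \<Rightarrow> bool" where
  "state R v N \<longleftrightarrow> R \<subseteq> internal \<and> v \<in> R \<and> par v \<notin> R \<and> (\<forall>c\<in>internal. par c \<in> R \<longrightarrow> c \<in> R) \<and>
     N = (\<lambda>u. {u, par u}) ` {u \<in> R. par u \<notin> R \<and> u \<noteq> v}"

lemma child_choice_extend: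
  assumes "child_choice (R - {v}) ch" "v \<in> R"
    and "c \<in> V" "c \<noteq> r" "par c = v" "(\<exists>c\<in>internal. par c = v) \<longrightarrow> c \<in> internal"
  shows "child_choice R (ch(v := c))"
    and "(\<Union>u\<in>R. {{u, par u}, second_pair (ch(v := c)) u})
      = {{v, par v}, if c \<in> internal then {par v, c} else {v, c}}
        \<union> (\<Union>u\<in>R - {v}. {{u, par u}, second_pair ch u})"
proof -
  show "child_choice R (ch(v := c))" using assms by (auto simp: child_choice_def)
  have "(\<Union>u\<in>R. {{u, par u}, second_pair (ch(v := c)) u})
    = {{v, par v}, second_pair (ch(v := c)) v} \<union> (\<Union>u\<in>R - {v}. {{u, par u}, second_pair (ch(v := c)) u})"
    using assms(2) by blast
  also have "(\<Union>u\<in>R - {v}. {{u, par u}, second_pair (ch(v := c)) u})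
    = (\<Union>u\<in>R - {v}. {{u, par u}, second_pair ch u})"
    by (intro SUP_cong) (auto simp: second_pair_def)
  also have "second_pair (ch(v := c)) v = (if c \<in> internal then {par v, c} else {v, c})"
    by (simp add: second_pair_def)
  finally show "(\<Union>u\<in>R. {{u, par u}, second_pair (ch(v := c)) u})
      = {{v, par v}, if c \<in> internal then {par v, c} else {v, c}}
        \<union> (\<Union>u\<in>R - {v}. {{u, par u}, second_pair ch u})" .
qed

lemma star_child:
  assumes "f \<in> star v" "f \<noteq> {v, par v}"
  obtains c where "c \<in> V" "c \<noteq> r" "par c = v" "f = {c, par c}"
  using assms by (metis insert_commute star_cases)

text \<open>By the invariant an internal child of \<open>v\<close> would lie in \<open>R\<close>,
  and its parent edge would violate the assumption on the star.\<close>

lemma state_leaf_star: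
  assumes st: "state R v N" and no: "\<forall>f\<in>star v. f \<inter> (R - {v}) = {}"
  shows "\<not> (\<exists>c\<in>internal. par c = v)"
proof
  assume "\<exists>c\<in>internal. par c = v"
  then obtain c where c: "c \<in> internal" "par c = v" by blast
  then have "c \<in> R" using st by (auto simp: state_def)
  have cV: "c \<in> V" "c \<noteq> r" using c internal_subset by auto
  have "c \<noteq> v" using c par_neq[OF cV] by metis
  have "{c, v} \<in> star v" using parent_edge[OF cV] c by (simp add: star_def)
  then have "{c, v} \<inter> (R - {v}) = {}" using no by (rule bspec[rotated])
  then show False using \<open>c \<in> R\<close> \<open>c \<noteq> v\<close> by auto
qed

text \<open>Rule induction over the run: each round removes \<open>v\<close> from \<open>R\<close>,
  and the choice obtained for the remaining vertices is extended by the child chosen at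
  \<open>v\<close>.\<close>

lemma alg_run_output:
  assumes "alg_run G N s Bacc Bout"
    and "G = (rest_verts R, rest_edges R)" "s = {v, par v}" "state R v N"
  shows "\<exists>ch. child_choice R ch \<and> Bout = Bacc \<union> (\<Union>u\<in>R. {{u, par u}, second_pair ch u})"
  using assms
proof (induction arbitrary: R v rule: alg_run.induct)
  case (step2 G s Bc c N' N G' Bacc Bout)
  note G = step2.prems(1) and s = step2.prems(2) and st = step2.prems(3)
  have R: "R \<subseteq> internal" and v: "v \<in> R" "par v \<notin> R"
    and down: "\<And>c. c \<in> internal \<Longrightarrow> par c \<in> R \<Longrightarrow> c \<in> R"
    and N: "N = (\<lambda>u. {u, par u}) ` {u \<in> R. par u \<notin> R \<and> u \<noteq> v}"
    using st by (auto simp: state_def)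
  have vV: "v \<in> V" "v \<noteq> r" and vI: "v \<in> internal" using R v internal_subset by auto
  \<comment> \<open>\<open>the_block_of\<close> includes uniqueness, so it is enough that the star
    is one block containing \<open>s\<close>.\<close>
  have Bc: "Bc = (star v, clique v)"
    using step2.hyps(1) star_is_block[OF R v] parent_edge[OF vV]
    unfolding the_block_of_def G s by (auto simp: star_def)
  note cut = star_cut_vertex_iff[OF R v]
  have cs: "c \<in> star v" using step2.hyps(2) Bc by simp
  then have "c \<inter> (R - {v}) \<noteq> {}" using step2.hyps(3) cut G by simp
  then obtain d where d: "d \<in> c" "d \<in> R" "d \<noteq> v" by auto
  have c_eq0: "c = {v, d}" using cs d by (intro edge_eqI) (auto simp: star_def)
  have "c \<noteq> {v, par v}" using c_eq0 d v by (auto simp: doubleton_eq_iff)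
  then obtain d' where "d' \<in> V" "d' \<noteq> r" "par d' = v" "c = {d', par d'}"
    using star_child[OF cs] by blast
  then have d': "d \<in> V" "d \<noteq> r" "par d = v" using c_eq0 d by (auto simp: doubleton_eq_iff)
  have c_eq: "c = {d, par d}" using c_eq0 d' by auto
  have cuts: "{f \<in> star v. f \<inter> (R - {v}) \<noteq> {} \<and> f \<noteq> c} = (\<lambda>u. {u, par u}) ` {u \<in> R. par u = v \<and> u \<noteq> d}"
  proof (intro equalityI subsetI)
    fix f assume "f \<in> {f \<in> star v. f \<inter> (R - {v}) \<noteq> {} \<and> f \<noteq> c}"
    then have f: "f \<in> star v" "f \<noteq> c" and "f \<inter> (R - {v}) \<noteq> {}" by auto
    then obtain u where u: "u \<in> f" "u \<in> R" "u \<noteq> v" by auto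
    have f_eq: "f = {v, u}" using f u by (intro edge_eqI) (auto simp: star_def)
    have "f \<noteq> {v, par v}" using f_eq u v by (auto simp: doubleton_eq_iff)
    then obtain u' where "u' \<in> V" "u' \<noteq> r" "par u' = v" "f = {u', par u'}"
      using star_child[OF f(1)] by blast
    then have "par u = v" "f = {u, par u}" using f_eq u by (auto simp: doubleton_eq_iff)
    then show "f \<in> (\<lambda>u. {u, par u}) ` {u \<in> R. par u = v \<and> u \<noteq> d}" using u f c_eq by auto
  next
    fix f assume "f \<in> (\<lambda>u. {u, par u}) ` {u \<in> R. par u = v \<and> u \<noteq> d}"
    then obtain u where u: "u \<in> R" "par u = v" "u \<noteq> d" "f = {u, par u}" by auto
    then have uV: "u \<in> V" "u \<noteq> r" using R internal_subset by auto
    have "f \<noteq> c" using parent_edge_inj[OF uV d'(1,2)] u c_eq by auto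
    moreover have "f \<in> star v" using parent_edge[OF uV] u by (auto simp: star_def)
    moreover have "u \<in> f \<inter> (R - {v})" using u par_neq[OF uV] by auto
    ultimately show "f \<in> {f \<in> star v. f \<inter> (R - {v}) \<noteq> {} \<and> f \<noteq> c}" by auto
  qed
  have N': "N' = N \<union> (\<lambda>u. {u, par u}) ` {u \<in> R. par u = v \<and> u \<noteq> d}"
    unfolding step2.hyps(4) cuts[symmetric] using cut G Bc by auto
  have G': "G' = (rest_verts (R - {v}), rest_edges (R - {v}))"
  proof -
    have "{f \<in> star v. \<not> cut_vertex (rest_verts R) (rest_edges R) f} = {f \<in> star v. f \<inter> (R - {v}) = {}}"
      using cut by auto
    then show ?thesis using rest_remove[OF v] unfolding step2.hyps(5) G Bc by simp
  qed
  have "state (R - {v}) d N'"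
  proof -
    \<comment> \<open>Removing \<open>v\<close> makes its internal children top vertices;
      \<open>d\<close> becomes the current one and the others join \<open>N'\<close>.\<close>
    have "{u \<in> R - {v}. par u \<notin> R - {v} \<and> u \<noteq> d}
        = {u \<in> R. par u \<notin> R \<and> u \<noteq> v} \<union> {u \<in> R. par u = v \<and> u \<noteq> d}"
      using v d d' R internal_subset par_neq by auto
    then show ?thesis
      using R v d d' down unfolding state_def N' N by (auto simp: image_Un)
  qed
  then obtain ch where ch: "child_choice (R - {v}) ch"
    "Bout = (Bacc \<union> {s, Defs.sym_diff s c}) \<union> (\<Union>u\<in>R - {v}. {{u, par u}, second_pair ch u})"
    using step2.IH[OF G' c_eq] by blast
  have dI: "d \<in> internal" using d R by auto
  then have int: "(\<exists>c\<in>internal. par c = v) \<longrightarrow> d \<in> internal" by blast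
  have "Defs.sym_diff s c = {par v, d}"
  proof -
    \<comment> \<open>The three vertices lie on different levels, so the symmetric difference
      cancels only \<open>v\<close>.\<close>
    have "dep d = Suc (dep v)" "dep v = Suc (dep (par v))"
      using dep_par[OF d'(1,2)] dep_par[OF vV] d'(3) by simp_all
    then have "dep d \<noteq> dep v" "dep d \<noteq> dep (par v)" "dep v \<noteq> dep (par v)" by linarith+
    then have "d \<noteq> v" "d \<noteq> par v" "v \<noteq> par v" by metis+
    then show ?thesis unfolding s c_eq0 Defs.sym_diff_def by auto
  qed
  then have "Bout = Bacc \<union> (\<Union>u\<in>R. {{u, par u}, second_pair (ch(v := d)) u})"
    unfolding ch(2) child_choice_extend(2)[OF ch(1) v(1) d' int] s using dI by auto
  then show ?case using child_choice_extend(1)[OF ch(1) v(1) d' int] by blast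
next
  case (step3_stop G s Bc c N Bacc)
  note G = step3_stop.prems(1) and s = step3_stop.prems(2) and st = step3_stop.prems(3)
  have R: "R \<subseteq> internal" and v: "v \<in> R" "par v \<notin> R"
    and N: "N = (\<lambda>u. {u, par u}) ` {u \<in> R. par u \<notin> R \<and> u \<noteq> v}"
    using st by (auto simp: state_def)
  have vV: "v \<in> V" "v \<noteq> r" and vI: "v \<in> internal" using R v internal_subset by auto
  have Bc: "Bc = (star v, clique v)"
    using step3_stop.hyps(1) star_is_block[OF R v] parent_edge[OF vV]
    unfolding the_block_of_def G s by (auto simp: star_def)
  have no: "\<forall>f\<in>star v. f \<inter> (R - {v}) = {}"
    using step3_stop.hyps(2) star_cut_vertex_iff[OF R v] unfolding G Bc by auto
  note noint = state_leaf_star[OF st no]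
  obtain d where d: "d \<in> V" "d \<noteq> r" "par d = v" "c = {d, par d}"
    using star_child[of c v] step3_stop.hyps(3,4) Bc s by auto
  have dI: "d \<notin> internal" using noint d by auto
  have noint': "(\<exists>c\<in>internal. par c = v) \<longrightarrow> d \<in> internal" using noint by blast
  \<comment> \<open>A shallowest further vertex of \<open>R\<close> would be a top vertex, because
    \<open>v\<close> has no internal child, and its parent edge would lie in the empty
    \<open>N\<close>.\<close>
  have "R - {v} = {}"
  proof (rule ccontr)
    assume "R - {v} \<noteq> {}"
    then obtain w where w: "w \<in> R - {v}" "\<And>u. u \<in> R - {v} \<Longrightarrow> dep w \<le> dep u"
      using exists_least_iff[of "\<lambda>k. \<exists>u\<in>R - {v}. dep u = k"] by (metis not_le ex_in_conv)
    have wV: "w \<in> V" "w \<noteq> r" "w \<in> internal" using w R internal_subset by auto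
    have "par w \<notin> R - {v}" using w(2)[of "par w"] dep_par[OF wV(1,2)] by auto
    moreover have "par w \<noteq> v" using noint wV by auto
    ultimately have "w \<in> {u \<in> R. par u \<notin> R \<and> u \<noteq> v}" using w by auto
    then show False using N step3_stop.hyps(5) by blast
  qed
  then obtain ch where "child_choice (R - {v}) ch" unfolding child_choice_def by blast
  note ext = child_choice_extend[OF this v(1) d(1-3) noint'] and c_eq = d(4)[unfolded d(3)]
  have "Bacc \<union> {s, c} = Bacc \<union> (\<Union>u\<in>R. {{u, par u}, second_pair (ch(v := d)) u})"
    unfolding c_eq s ext(2) \<open>R - {v} = {}\<close> using dI by (simp add: insert_commute)
  then show ?case using ext(1) by blast
next
  case (step3_next G s Bc c s' N Bacc Bout)
  note G = step3_next.prems(1) and s = step3_next.prems(2) and st = step3_next.prems(3)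
  have R: "R \<subseteq> internal" and v: "v \<in> R" "par v \<notin> R"
    and down: "\<And>c. c \<in> internal \<Longrightarrow> par c \<in> R \<Longrightarrow> c \<in> R"
    and N: "N = (\<lambda>u. {u, par u}) ` {u \<in> R. par u \<notin> R \<and> u \<noteq> v}"
    using st by (auto simp: state_def)
  have vV: "v \<in> V" "v \<noteq> r" and vI: "v \<in> internal" using R v internal_subset by auto
  have Bc: "Bc = (star v, clique v)"
    using step3_next.hyps(1) star_is_block[OF R v] parent_edge[OF vV]
    unfolding the_block_of_def G s by (auto simp: star_def)
  have no: "\<forall>f\<in>star v. f \<inter> (R - {v}) = {}"
    using step3_next.hyps(2) star_cut_vertex_iff[OF R v] unfolding G Bc by auto
  note noint = state_leaf_star[OF st no]
  obtain d where d: "d \<in> V" "d \<noteq> r" "par d = v" "c = {d, par d}"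
    using star_child[of c v] step3_next.hyps(3,4) Bc s by auto
  have dI: "d \<notin> internal" using noint d by auto
  have noint': "(\<exists>c\<in>internal. par c = v) \<longrightarrow> d \<in> internal" using noint by blast
  obtain v' where v': "v' \<in> R" "par v' \<notin> R" "v' \<noteq> v" "s' = {v', par v'}"
    using step3_next.hyps(5) N by auto
  \<comment> \<open>No vertex of the star is a cut vertex, so deleting all of them has the same
    effect as the deletion in Step 2; the clique edges go with their ends.\<close>
  have G': "del_verts (fst G) (snd G) (fst Bc) = (rest_verts (R - {v}), rest_edges (R - {v}))"
  proof -
    have "{f \<in> star v. f \<inter> (R - {v}) = {}} = star v" using no by auto
    moreover have "{h \<in> rest_edges R - clique v. h \<inter> star v = {}} = {h \<in> rest_edges R. h \<inter> star v = {}}"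
      by (auto simp: clique_def)
    ultimately show ?thesis using rest_remove[OF v] unfolding G Bc del_verts_def by simp
  qed
  have "state (R - {v}) v' (N - {s'})"
  proof -
    \<comment> \<open>Since \<open>v\<close> has no internal child, its removal creates no new top
      vertex.\<close>
    have tops: "{u \<in> R - {v}. par u \<notin> R - {v} \<and> u \<noteq> v'} = {u \<in> R. par u \<notin> R \<and> u \<noteq> v} - {v'}"
      using noint R by auto
    have "inj_on (\<lambda>u. {u, par u}) R"
      using R internal_subset by (intro inj_onI parent_edge_inj) auto
    then have "N - {s'} = (\<lambda>u. {u, par u}) ` ({u \<in> R. par u \<notin> R \<and> u \<noteq> v} - {v'})"
      unfolding N v'(4) using v' by (subst inj_on_image_set_diff[where C = R]) auto
    then show ?thesis
      using R v v' down unfolding state_def tops by auto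
  qed
  then obtain ch where ch: "child_choice (R - {v}) ch"
    "Bout = (Bacc \<union> {s, c}) \<union> (\<Union>u\<in>R - {v}. {{u, par u}, second_pair ch u})"
    using step3_next.IH[OF G' v'(4)] by blast
  note ext = child_choice_extend[OF ch(1) v(1) d(1-3) noint'] and c_eq = d(4)[unfolded d(3)]
  have "Bout = Bacc \<union> (\<Union>u\<in>R. {{u, par u}, second_pair (ch(v := d)) u})"
    unfolding ch(2) ext(2) c_eq s using dI by (simp add: insert_commute Un_assoc)
  then show ?case using ext(1) by blast
qed

end

section \<open>Factorisation of the matrix\<close>

definition int_span :: "'k set \<Rightarrow> ('k \<Rightarrow> 'k \<Rightarrow> real) \<Rightarrow> ('k \<Rightarrow> real) \<Rightarrow> bool" where
  "int_span K U f \<longleftrightarrow> (\<exists>c. (\<forall>i\<in>K. c i \<in> \<int>) \<and> (\<forall>j\<in>K. f j = (\<Sum>i\<in>K. c i * U i j)))"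

lemma int_span_row:
  assumes "finite K" "i \<in> K"
  shows "int_span K U (U i)"
  unfolding int_span_def
proof (intro exI conjI ballI)
  fix j
  have "(\<Sum>k\<in>K. of_bool (k = i) * U k j) = (\<Sum>k\<in>K. if k = i then U i j else 0)"
    by (intro sum.cong) auto
  then show "U i j = (\<Sum>k\<in>K. of_bool (k = i) * U k j)" using assms by simp
qed auto

lemma int_span_cong:
  assumes "int_span K U f" "\<And>j. j \<in> K \<Longrightarrow> g j = f j"
  shows "int_span K U g"
  using assms unfolding int_span_def by auto

lemma int_span_diff:
  assumes "int_span K U f" "int_span K U g"
  shows "int_span K U (\<lambda>j. f j - g j)"
proof -
  obtain c d where "\<forall>i\<in>K. c i \<in> \<int>" "\<forall>j\<in>K. f j = (\<Sum>i\<in>K. c i * U i j)"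
    "\<forall>i\<in>K. d i \<in> \<int>" "\<forall>j\<in>K. g j = (\<Sum>i\<in>K. d i * U i j)"
    using assms unfolding int_span_def by blast
  then show ?thesis unfolding int_span_def
    by (intro exI[of _ "\<lambda>i. c i - d i"]) (auto simp: left_diff_distrib sum_subtractf)
qed

lemma int_span_zero: "int_span K U (\<lambda>_. 0)"
  unfolding int_span_def by (intro exI[of _ "\<lambda>_. 0"]) auto

lemma int_span_add:
  assumes "int_span K U f" "int_span K U g"
  shows "int_span K U (\<lambda>j. f j + g j)"
  using int_span_diff[OF assms(1) int_span_diff[OF int_span_zero assms(2)]] by simp

lemma int_span_sum:
  assumes "\<And>a. a \<in> A \<Longrightarrow> int_span K U (f a)"
  shows "int_span K U (\<lambda>j. \<Sum>a\<in>A. f a j)"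
  using assms
proof (induction A rule: infinite_finite_induct)
  case (insert a A)
  have "int_span K U (\<lambda>j. f a j + (\<Sum>a\<in>A. f a j))" using insert by (intro int_span_add) auto
  then show ?case using insert.hyps by simp
qed (simp_all add: int_span_zero)

text \<open>The root is a leaf with neighbour \<open>q\<close>. Here \<open>ch_q\<close> is what
  remains of T not being a star: \<open>q\<close> has an internal child, so
  \<open>child_choice\<close> forces an internal choice at \<open>q\<close>.\<close>

locale chosen_tree = rooted_tree +
  fixes q and ch :: "'a \<Rightarrow> 'a"
  assumes q_internal: "q \<in> internal" and par_q: "par q = r"
    and only_q: "\<And>v. v \<in> V \<Longrightarrow> v \<noteq> r \<Longrightarrow> par v = r \<Longrightarrow> v = q"
    and choice: "child_choice internal ch" and ch_q: "ch q \<in> internal"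
begin

definition len :: "'a set \<Rightarrow> real" where
  "len P = (\<Sum>u\<in>V - {r}. of_bool (splits u P))"

text \<open>Coordinates in which \<open>max4pc\<close> becomes an orthogonal sum of hyperbolic planes, one for each
  internal edge \<open>{u, par u}\<close>, and one more, at the slot of \<open>u = q\<close>, for the sum of the two path
  lengths.\<close>

definition coord :: "'a set \<Rightarrow> 'a \<times> bool \<Rightarrow> real" where
  "coord P k = (let u = fst k; b = snd k in
     if u = q then (if b then 1 else len P)
     else of_bool (if b then P \<inter> sub u = {} else P \<subseteq> sub u))"

definition wt :: "'a \<Rightarrow> real" where
  "wt u = (if u = q then 1 else 2)"

definition index :: "('a \<times> bool) set" where
  "index = internal \<times> UNIV"

definition row :: "'a \<times> bool \<Rightarrow> 'a set" where
  "row k = (if snd k then second_pair ch (fst k) else {fst k, par (fst k)})"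

lemma internalD: "v \<in> internal \<Longrightarrow> v \<in> V" "v \<in> internal \<Longrightarrow> v \<noteq> r"
  using internal_subset by auto

lemma ch:
  assumes "v \<in> internal"
  shows "ch v \<in> V" "ch v \<noteq> r" "par (ch v) = v"
  using choice assms by (auto simp: child_choice_def)

lemma finite_index: "finite index"
  by (simp add: index_def finite_internal)

lemma sum_index: "(\<Sum>k\<in>index. f k) = (\<Sum>u\<in>internal. f (u, False) + f (u, True))"
proof -
  have "(\<Sum>k\<in>index. f k) = (\<Sum>u\<in>internal. \<Sum>b\<in>UNIV. f (u, b))"
    unfolding index_def sum.cartesian_product by simp
  then show ?thesis by (simp add: UNIV_bool add.commute)
qed

lemma in_sub_q: "v \<in> V \<Longrightarrow> v \<noteq> r \<Longrightarrow> v \<in> sub q"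
proof (induction v rule: dep_induct)
  case (step v)
  then show ?case using only_q[of v] sub_step[of v q] by (cases "par v = r") auto
qed simp

text \<open>A separating edge has two vertices on each side. The parent edge of a leaf has only that
  leaf below it, and that of \<open>q\<close> has only \<open>r\<close> above it.\<close>

lemma separates_pair_eq_0:
  assumes P: "P \<in> pairs V" and Q: "Q \<in> pairs V" and u: "u \<in> V - {r}" "u \<notin> internal - {q}"
  shows "\<not> separates u P Q"
proof -
  have no: "\<not> P \<subseteq> {x}" if "P \<in> pairs V" for P x
  proof
    assume "P \<subseteq> {x}"
    then have "card P \<le> card {x}" by (intro card_mono) auto
    then show False using that by (simp add: pairs_def)
  qed
  show ?thesis
  proof (cases "u = q")
    case True
    have "P \<subseteq> {r}" if "P \<in> pairs V" "P \<inter> sub q = {}" for P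
      using that in_sub_q by (auto simp: pairs_def)
    from this[OF P] this[OF Q] show ?thesis using no[OF P] no[OF Q] True unfolding separates_def by metis
  next
    case False
    then have "sub u = {u}" using sub_leaf u by blast
    then show ?thesis using no P Q unfolding separates_def by simp
  qed
qed

text \<open>The right-hand side depends only on the sets \<open>P\<close> and \<open>Q\<close>, not
  on the naming of their elements, so the definite description in \<open>max4pc\<close> is well
  defined.\<close>

lemma max4pc_eq_sum:
  assumes P: "P \<in> pairs V" and Q: "Q \<in> pairs V"
  shows "max4pc E P Q = (\<Sum>u\<in>V - {r}. of_bool (splits u P) + of_bool (splits u Q)
        + 2 * of_bool (separates u P Q))" (is "_ = ?m")
proof -
  obtain w x y z where wz: "P = {w, x}" "Q = {y, z}"
    using P Q by (auto simp: pairs_def card_2_iff)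
  have eq: "real (max (tdist E w x + tdist E y z) (max (tdist E w y + tdist E x z) (tdist E w z + tdist E x y))) = ?m"
    if "P = {w, x}" "Q = {y, z}" for w x y z
  proof -
    have "w \<in> V" "x \<in> V" "y \<in> V" "z \<in> V" using that P Q by (auto simp: pairs_def)
    then show ?thesis unfolding that by (subst max_sums_eq) simp_all
  qed
  show ?thesis unfolding max4pc_def
  proof (rule the_equality)
    show "\<exists>w x y z. P = {w, x} \<and> Q = {y, z} \<and> ?m = real (max (tdist E w x + tdist E y z)
        (max (tdist E w y + tdist E x z) (tdist E w z + tdist E x y)))"
      using wz eq[OF wz, symmetric] by blast
  next
    fix m assume "\<exists>w x y z. P = {w, x} \<and> Q = {y, z} \<and> m = real (max (tdist E w x + tdist E y z)
        (max (tdist E w y + tdist E x z) (tdist E w z + tdist E x y)))"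
    then show "m = ?m" using eq by (elim exE conjE) (simp only:)
  qed
qed

lemma max4pc_eq_coord:
  assumes P: "P \<in> pairs V" and Q: "Q \<in> pairs V"
  shows "max4pc E P Q = (\<Sum>k\<in>index. coord P k * (wt (fst k) * coord Q (fst k, \<not> snd k)))"
proof -
  have ne: "P \<noteq> {}" "Q \<noteq> {}" using P Q by (auto simp: pairs_def)
  have "(\<Sum>u\<in>V - {r}. of_bool (separates u P Q)) = (\<Sum>u\<in>internal - {q}. of_bool (separates u P Q) :: real)"
    using fin internal_subset separates_pair_eq_0[OF P Q] by (intro sum.mono_neutral_right) auto
  moreover have "of_bool (separates u P Q) = coord P (u, False) * coord Q (u, True) + coord P (u, True) * coord Q (u, False)"
    if "u \<in> internal - {q}" for u
  proof -
    \<comment> \<open>Since the pairs are nonempty, the two alternatives in \<open>separates\<close>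
      exclude each other, and the indicator of the disjunction is a sum of products.\<close>
    have "\<not> (P \<subseteq> sub u \<and> P \<inter> sub u = {})" "\<not> (Q \<subseteq> sub u \<and> Q \<inter> sub u = {})" using ne by auto
    then show ?thesis using that unfolding coord_def separates_def by (auto simp: Let_def)
  qed
  ultimately have sep: "(\<Sum>u\<in>V - {r}. of_bool (separates u P Q))
    = (\<Sum>u\<in>internal - {q}. coord P (u, False) * coord Q (u, True) + coord P (u, True) * coord Q (u, False))"
    by simp
  have "max4pc E P Q = len P + len Q + 2 * (\<Sum>u\<in>V - {r}. of_bool (separates u P Q))"
    unfolding max4pc_eq_sum[OF P Q] len_def by (simp add: sum.distrib sum_distrib_left)
  also have "\<dots> = (coord P (q, False) * (wt q * coord Q (q, True)) + coord P (q, True) * (wt q * coord Q (q, False)))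
    + (\<Sum>u\<in>internal - {q}. coord P (u, False) * (wt u * coord Q (u, True)) + coord P (u, True) * (wt u * coord Q (u, False)))"
    unfolding sep sum_distrib_left
    by (intro arg_cong2[of _ _ _ _ "(+)"] sum.cong) (auto simp: coord_def wt_def algebra_simps)
  also have "\<dots> = (\<Sum>u\<in>internal. coord P (u, False) * (wt u * coord Q (u, True)) + coord P (u, True) * (wt u * coord Q (u, False)))"
    by (rule sum.remove[OF finite_internal q_internal, symmetric])
  finally show ?thesis unfolding sum_index by simp
qed

lemma len_pair: "len {a, b} = card (separators a b)"
proof -
  have "len {a, b} = (\<Sum>u\<in>V - {r}. of_bool ((a \<in> sub u) \<noteq> (b \<in> sub u)))"
    unfolding len_def splits_def by (intro sum.cong) auto
  then show ?thesis using fin by (simp add: separators_def Int_def)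
qed

text \<open>A set \<open>sub u\<close> that contains \<open>par v\<close> also contains
  \<open>v\<close>, so the upper end decides containment of the edge and the lower end decides
  disjointness.\<close>

lemma coord_first:
  assumes v: "v \<in> internal"
  shows "coord (row (v, False)) (u, b)
    = (if u = q then 1 else of_bool (if b then v \<notin> sub u else par v \<in> sub u))"
proof -
  have "v \<in> V" "v \<noteq> r" using internalD v by auto
  then show ?thesis
    unfolding coord_def row_def using sub_step[of v u]
    by (auto simp: Let_def len_pair separators_par)
qed

text \<open>For internal \<open>u\<close> the leaf \<open>ch v\<close> differs from
  \<open>u\<close>, hence lies in \<open>sub u\<close> exactly when \<open>v\<close> does: the pair
  looks like the single vertex \<open>v\<close>.\<close>

lemma coord_second_leaf:
  assumes v: "v \<in> internal" and c: "ch v \<notin> internal" and u: "u \<in> internal"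
  shows "coord (row (v, True)) (u, b)
    = (if u = q then 1 else of_bool (if b then v \<notin> sub u else v \<in> sub u))"
proof -
  have "u \<noteq> ch v" using c u by auto
  moreover have "len {v, ch v} = 1"
    using separators_par[OF ch(1,2)[OF v]] ch(3)[OF v] by (simp add: len_pair separators_sym[of v])
  ultimately show ?thesis
    unfolding coord_def row_def second_pair_def using sub_step[OF ch(1)[OF v], of u] ch(3)[OF v] c
    by (auto simp: Let_def)
qed

lemma coord_second_internal:
  assumes v: "v \<in> internal" and c: "ch v \<in> internal"
  shows "coord (row (v, True)) (u, b)
    = (if u = q then (if b then 1 else 2) else of_bool (if b then ch v \<notin> sub u else par v \<in> sub u))"
proof -
  have vV: "v \<in> V" "v \<noteq> r" using internalD v by auto
  note step = sub_step[OF ch(1)[OF v], unfolded ch(3)[OF v]] sub_step[OF vV(1)]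
  have "v \<noteq> ch v" using ch[OF v] par_neq by metis
  have "separators (par v) (ch v) = {v, ch v}"
  proof -
    have "par v \<notin> sub v" using par_notin_sub[OF vV] .
    moreover have "v \<notin> sub (ch v)" using par_notin_sub[OF ch(1,2)[OF v]] ch(3)[OF v] by simp
    then have "par v \<notin> sub (ch v)" using sub_step[OF vV(1)] by blast
    ultimately show ?thesis
      using vV ch(1,2)[OF v] sub_refl unfolding separators_def by (auto simp: step)
  qed
  then have "len {par v, ch v} = 2" using \<open>v \<noteq> ch v\<close> by (simp add: len_pair)
  then show ?thesis
    unfolding coord_def row_def second_pair_def using c step[of u] by (auto simp: Let_def)
qed

section \<open>The output rows generate the integer lattice\<close>

abbreviation unit_row :: "'a \<times> bool \<Rightarrow> 'a \<times> bool \<Rightarrow> real" where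
  "unit_row k \<equiv> (\<lambda>j. of_bool (j = k))"

text \<open>Write F(v) and T(v) for the two unit rows at \<open>v\<close>. For \<open>v\<close>
  other than \<open>q\<close>, consecutive first rows differ by F(par v) - T(v), where F(par v) is
  absent if \<open>par v = q\<close>. The second row at \<open>v\<close> minus the first is F(q) -
  T(ch v) if \<open>ch v\<close> is internal, and F(v) if \<open>ch v\<close> is a leaf and
  \<open>v\<close> is not \<open>q\<close>. So T is known at the internal children of
  \<open>q\<close>, then F(q) follows from \<open>ch q\<close>, then F(v) directly or through T(ch
  v), then T(v) from F(par v), and T(q) last.\<close>

lemma unit_row_int_span:
  assumes "k \<in> index"
  shows "int_span index (\<lambda>k. coord (row k)) (unit_row k)"
proof -
  let ?S = "int_span index (\<lambda>k. coord (row k))"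
  have rows: "?S (coord (row (v, b)))" if "v \<in> internal" for v b
    using int_span_row[OF finite_index, of "(v, b)" "\<lambda>k. coord (row k)"] that
    by (simp add: index_def)
  \<comment> \<open>The factor \<open>of_bool (par v \<noteq> q)\<close> arises because the slots of
    \<open>q\<close> hold the length and the constant, which are 1 for every edge and
    cancel.\<close>
  have step: "?S (\<lambda>j. coord (row (v, False)) j - coord (row (par v, False)) j)"
    and step_eq: "coord (row (v, False)) (u, b) - coord (row (par v, False)) (u, b)
      = of_bool (par v \<noteq> q) * unit_row (par v, False) (u, b) - unit_row (v, True) (u, b)"
    if v: "v \<in> internal" "v \<noteq> q" for v u b
  proof -
    have "par v \<noteq> r" using only_q internalD v by blast
    then have t: "par v \<in> internal" using par_internal internalD v by auto
    show "?S (\<lambda>j. coord (row (v, False)) j - coord (row (par v, False)) j)"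
      using rows v t by (intro int_span_diff) auto
    have "par v \<notin> sub v" "par (par v) \<notin> sub (par v)"
      using par_notin_sub internalD v t by auto
    moreover have "v \<in> sub u \<longleftrightarrow> v = u \<or> par v \<in> sub u" "par v \<in> sub u \<longleftrightarrow> par v = u \<or> par (par v) \<in> sub u"
      using sub_step internalD v t by auto
    ultimately show "coord (row (v, False)) (u, b) - coord (row (par v, False)) (u, b)
      = of_bool (par v \<noteq> q) * unit_row (par v, False) (u, b) - unit_row (v, True) (u, b)"
      unfolding coord_first[OF v(1)] coord_first[OF t] using v by (cases b) auto
  qed
  have first_child: "?S (unit_row (v, True))" if v: "v \<in> internal" "v \<noteq> q" "par v = q" for v
  proof (rule int_span_cong[OF int_span_diff[OF int_span_zero step[OF v(1,2)]]])
    fix j show "unit_row (v, True) j = 0 - (coord (row (v, False)) j - coord (row (par v, False)) j)"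
      by (cases j, simp only: step_eq[OF v(1,2)]) (simp add: v(3))
  qed
  have second_eq: "coord (row (v, True)) (u, b) - coord (row (v, False)) (u, b)
      = unit_row (q, False) (u, b) - unit_row (ch v, True) (u, b)"
    if v: "v \<in> internal" "ch v \<in> internal" for v u b
  proof -
    have "ch v \<noteq> q" using ch(3)[OF v(1)] par_q internalD(2)[OF v(1)] by auto
    moreover have "v \<notin> sub (ch v)" using par_notin_sub[OF ch(1,2)[OF v(1)]] ch(3)[OF v(1)] by simp
    moreover have "ch v \<in> sub u \<longleftrightarrow> ch v = u \<or> v \<in> sub u" using sub_step[OF ch(1)[OF v(1)]] ch(3)[OF v(1)] by simp
    ultimately show ?thesis
      unfolding coord_first[OF v(1)] coord_second_internal[OF v] by (cases b) auto
  qed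
  \<comment> \<open>The pair \<open>{r, ch q}\<close> has length 2 and the edge at \<open>r\<close>
    has length 1; this difference is what isolates the length coordinate.\<close>
  have qF: "?S (unit_row (q, False))"
  proof -
    have "ch q \<noteq> q" using ch(3)[OF q_internal] par_q internalD(2)[OF q_internal] by auto
    then have "?S (unit_row (ch q, True))" using first_child ch_q ch(3)[OF q_internal] by blast
    then have "?S (\<lambda>j. (coord (row (q, True)) j - coord (row (q, False)) j) + unit_row (ch q, True) j)"
      using rows q_internal by (intro int_span_add int_span_diff) auto
    then show ?thesis
    proof (rule int_span_cong)
      fix j show "unit_row (q, False) j
          = (coord (row (q, True)) j - coord (row (q, False)) j) + unit_row (ch q, True) j"
        by (cases j) (simp only: second_eq[OF q_internal ch_q] diff_add_cancel)
    qed
  qed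
  have F: "?S (unit_row (v, False))" if v: "v \<in> internal" "v \<noteq> q" for v
  proof (cases "ch v \<in> internal")
    case False
    have sv: "v \<in> sub u \<longleftrightarrow> v = u \<or> par v \<in> sub u" for u using sub_step internalD v by auto
    have nv: "par v \<notin> sub v" using par_notin_sub internalD v by auto
    have "?S (\<lambda>j. coord (row (v, True)) j - coord (row (v, False)) j)"
      using rows v by (intro int_span_diff) auto
    then show ?thesis
    proof (rule int_span_cong)
      fix j assume "j \<in> index"
      then obtain u b where j: "j = (u, b)" "u \<in> internal" by (auto simp: index_def)
      show "unit_row (v, False) j = coord (row (v, True)) j - coord (row (v, False)) j"
        unfolding j(1) coord_first[OF v(1)] coord_second_leaf[OF v(1) False j(2)]
        using v sv[of u] nv by (cases b) auto
    qed
  next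
    case True
    have c: "ch v \<noteq> q" using ch(3)[OF v(1)] par_q internalD(2)[OF v(1)] by auto
    have cT: "?S (unit_row (ch v, True))"
    proof -
      have "?S (\<lambda>j. unit_row (q, False) j - (coord (row (v, True)) j - coord (row (v, False)) j))"
        using rows v qF by (intro int_span_diff) auto
      then show ?thesis
      proof (rule int_span_cong)
        fix j show "unit_row (ch v, True) j
            = unit_row (q, False) j - (coord (row (v, True)) j - coord (row (v, False)) j)"
          by (cases j) (simp only: second_eq[OF v(1) True] diff_diff_eq2 add_diff_cancel_left')
      qed
    qed
    have "?S (\<lambda>j. (coord (row (ch v, False)) j - coord (row (par (ch v), False)) j) + unit_row (ch v, True) j)"
      using cT step[OF True c] by (intro int_span_add)
    then show ?thesis
    proof (rule int_span_cong)
      fix j show "unit_row (v, False) j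
          = (coord (row (ch v, False)) j - coord (row (par (ch v), False)) j) + unit_row (ch v, True) j"
        by (cases j, simp only: step_eq[OF True c]) (simp add: ch(3)[OF v(1)] v(2))
    qed
  qed
  have T: "?S (unit_row (v, True))" if v: "v \<in> internal" "v \<noteq> q" for v
  proof (cases "par v = q")
    case True
    then show ?thesis using first_child v by blast
  next
    case False
    have "par v \<noteq> r" using only_q internalD v by blast
    then have t: "par v \<in> internal" using par_internal internalD v by auto
    have "?S (\<lambda>j. unit_row (par v, False) j - (coord (row (v, False)) j - coord (row (par v, False)) j))"
      using F[OF t False] step[OF v] by (rule int_span_diff)
    then show ?thesis
    proof (rule int_span_cong)
      fix j show "unit_row (v, True) j
          = unit_row (par v, False) j - (coord (row (v, False)) j - coord (row (par v, False)) j)"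
        by (cases j, simp only: step_eq[OF v]) (simp add: False)
    qed
  qed
  have qT: "?S (unit_row (q, True))"
  proof -
    \<comment> \<open>The first row at \<open>q\<close> is 1 at both slots of \<open>q\<close> and
      at the \<open>True\<close> slot of every other internal vertex, and 0 elsewhere.\<close>
    have "?S (\<lambda>j. coord (row (q, False)) j - (unit_row (q, False) j + (\<Sum>u\<in>internal - {q}. unit_row (u, True) j)))"
      using rows q_internal qF T by (intro int_span_diff int_span_add int_span_sum) auto
    then show ?thesis
    proof (rule int_span_cong)
      fix j assume "j \<in> index"
      then obtain u b where j: "j = (u, b)" "u \<in> internal" by (auto simp: index_def)
      have "(\<Sum>w\<in>internal - {q}. unit_row (w, True) j) = (\<Sum>w\<in>internal - {q}. if w = u then of_bool b else 0)"
        unfolding j(1) by (intro sum.cong) auto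
      also have "\<dots> = of_bool (u \<noteq> q \<and> b)" using j finite_internal by (simp add: sum.delta)
      finally have sum: "(\<Sum>w\<in>internal - {q}. unit_row (w, True) j) = of_bool (u \<noteq> q \<and> b)" .
      have "r \<notin> sub u" using r_in_sub internalD j by auto
      then have "q \<in> sub u \<longleftrightarrow> q = u" using sub_step[of q u] internalD(1)[OF q_internal] par_q by auto
      then show "unit_row (q, True) j = coord (row (q, False)) j
          - (unit_row (q, False) j + (\<Sum>u\<in>internal - {q}. unit_row (u, True) j))"
        unfolding sum unfolding j(1) coord_first[OF q_internal] par_q using \<open>r \<notin> sub u\<close> by (cases b) auto
    qed
  qed
  obtain v b where "k = (v, b)" "v \<in> internal" using assms by (auto simp: index_def)
  then show ?thesis using F T qF qT by (cases "v = q"; cases b) auto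
qed

section \<open>Distinctness of the output pairs\<close>

lemma second_internal_not_edge:
  assumes v: "v \<in> internal" and w: "w \<in> V" "w \<noteq> r"
  shows "{par v, ch v} \<noteq> {w, par w}"
proof
  assume "{par v, ch v} = {w, par w}"
  then consider "par v = w" "ch v = par w" | "par v = par w" "ch v = w"
    by (auto simp: doubleton_eq_iff)
  moreover have "dep w = Suc (dep (par w))" by (rule dep_par[OF w])
  moreover have "dep (ch v) = Suc (Suc (dep (par v)))"
    using dep_par[OF ch(1,2)[OF v]] dep_par[OF internalD[OF v]] ch(3)[OF v] by simp
  ultimately show False by cases simp_all
qed

lemma second_internal_inj:
  assumes "v \<in> internal" "w \<in> internal" "{par v, ch v} = {par w, ch w}"
  shows "v = w"
proof -
  have "dep (ch v) = Suc (Suc (dep (par v)))" "dep (ch w) = Suc (Suc (dep (par w)))"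
    using dep_par[OF ch(1,2)] dep_par[OF internalD] ch(3) assms by auto
  then have "ch v = ch w" using assms(3) by (auto simp: doubleton_eq_iff)
  then show ?thesis using ch(3) assms by metis
qed

text \<open>A parent edge is determined by its lower end, which is internal for a first pair and a
  leaf for a second pair of leaf type. The remaining pairs span two levels, so they are not edges,
  and their lower end determines the vertex.\<close>

lemma inj_row: "inj_on row index"
proof (rule inj_onI)
  fix k l assume "k \<in> index" "l \<in> index" and eq: "row k = row l"
  then obtain v b w b' where vw: "k = (v, b)" "l = (w, b')" "v \<in> internal" "w \<in> internal"
    by (auto simp: index_def)
  have leaf: "second_pair ch u = {ch u, par (ch u)}" if "u \<in> internal" "ch u \<notin> internal" for u
    using ch(3)[OF that(1)] that by (auto simp: second_pair_def)
  have int: "second_pair ch u = {par u, ch u}" if "ch u \<in> internal" for u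
    using that by (simp add: second_pair_def)
  have not_first: "second_pair ch u \<noteq> {w, par w}" if "u \<in> internal" "w \<in> internal" for u w
  proof (cases "ch u \<in> internal")
    case True
    then show ?thesis using int second_internal_not_edge internalD that by simp
  next
    case False
    then show ?thesis using leaf parent_edge_inj[of "ch u" w] ch internalD that by metis
  qed
  have second: "u = w" if "u \<in> internal" "w \<in> internal" "second_pair ch u = second_pair ch w" for u w
  proof (cases "ch u \<in> internal"; cases "ch w \<in> internal")
    assume "ch u \<in> internal" "ch w \<in> internal"
    then show ?thesis using int second_internal_inj that by metis
  next
    assume "ch u \<in> internal" "ch w \<notin> internal"
    then show ?thesis using int leaf second_internal_not_edge ch that by metis
  next
    assume "ch u \<notin> internal" "ch w \<in> internal"
    then show ?thesis using int leaf second_internal_not_edge ch that by metis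
  next
    assume "ch u \<notin> internal" "ch w \<notin> internal"
    then have "ch u = ch w" using leaf parent_edge_inj[of "ch u" "ch w"] ch that by metis
    then show ?thesis using ch(3) that by metis
  qed
  show "k = l"
  proof (cases b; cases b')
    assume "b" "b'"
    then show ?thesis using eq vw second by (simp add: row_def)
  next
    assume "b" "\<not> b'"
    then show ?thesis using eq vw not_first by (simp add: row_def)
  next
    assume "\<not> b" "b'"
    then show ?thesis using eq vw not_first[of w v] by (simp add: row_def)
  next
    assume "\<not> b" "\<not> b'"
    then show ?thesis using eq vw parent_edge_inj internalD by (simp add: row_def)
  qed
qed

lemma row_image: "row ` index = (\<Union>u\<in>internal. {{u, par u}, second_pair ch u})"
proof -
  have "index = (\<Union>u\<in>internal. {(u, False), (u, True)})" by (auto simp: index_def)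
  moreover have "row (u, False) = {u, par u}" "row (u, True) = second_pair ch u" for u
    by (simp_all add: row_def)
  ultimately show ?thesis by (simp only: image_UN image_insert image_empty)
qed

lemma row_in_pairs:
  assumes "k \<in> index" shows "row k \<in> pairs V"
proof -
  obtain v b where v: "k = (v, b)" "v \<in> internal" using assms by (auto simp: index_def)
  have vV: "v \<in> V" "v \<noteq> r" using internalD v by auto
  have "v \<noteq> par v" "par v \<in> V" using par_neq[OF vV] par_in vV by auto
  moreover have "v \<noteq> ch v" using ch[OF v(2)] par_neq by metis
  moreover have "par v \<noteq> ch v"
  proof
    assume "par v = ch v"
    moreover have "dep (ch v) = Suc (Suc (dep (par v)))"
      using dep_par[OF ch(1,2)[OF v(2)]] dep_par[OF vV] ch(3)[OF v(2)] by simp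
    ultimately show False by simp
  qed
  ultimately show ?thesis
    using v vV ch[OF v(2)] by (auto simp: row_def second_pair_def pairs_def)
qed

lemma row_basis_and_det:
  shows "card (row ` index) = 2 * card internal"
    and "det_on (row ` index) (max4pc E) = (-1) ^ card internal * 2 ^ (2 * (card internal - 1))"
    and "rows_basis (pairs V) (row ` index) (max4pc E)"
proof -
  let ?K = "index" and ?B = "row ` index" and ?M = "max4pc E"
  let ?U = "\<lambda>k. coord (row k)"
  let ?S = "\<lambda>i j. if fst i = fst j \<and> snd i \<noteq> snd j then wt (fst i) else 0"
  note finK = finite_index
  show "card ?B = 2 * card internal"
    unfolding card_image[OF inj_row] by (simp add: index_def card_cartesian_product)
  have "\<forall>k\<in>?K. \<exists>c. (\<forall>i\<in>?K. c i \<in> \<int>) \<and> (\<forall>j\<in>?K. unit_row k j = (\<Sum>i\<in>?K. c i * ?U i j))"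
    using unit_row_int_span unfolding int_span_def by blast
  from bchoice[OF this] obtain C where C_all:
    "\<forall>k\<in>?K. (\<forall>i\<in>?K. C k i \<in> \<int>) \<and> (\<forall>j\<in>?K. unit_row k j = (\<Sum>i\<in>?K. C k i * ?U i j))"
    by (elim exE)
  then have C_int: "\<And>k i. k \<in> ?K \<Longrightarrow> i \<in> ?K \<Longrightarrow> C k i \<in> \<int>"
    by blast
  have C: "unit_row k j = (\<Sum>i\<in>?K. C k i * ?U i j)" if "k \<in> ?K" "j \<in> ?K" for k j
    using bspec[OF conjunct2[OF bspec[OF C_all that(1)]] that(2)] .
  have detU: "(det_on ?K ?U)\<^sup>2 = 1"
  proof (rule det_on_inverse_Ints[OF finK, where C = C])
    have "len P \<in> \<int>" for P
      unfolding len_def by (intro Ints_sum) (simp add: of_bool_def)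
    then show "?U i j \<in> \<int>" for i j
      unfolding coord_def by (simp add: Let_def of_bool_def)
    show "C i j \<in> \<int>" if "i \<in> ?K" "j \<in> ?K" for i j using C_int that .
    show "(\<Sum>k\<in>?K. C i k * ?U k j) = (if i = j then 1 else 0)" if "i \<in> ?K" "j \<in> ?K" for i j
      using C[OF that] by auto
  qed
  have detS: "det_on ?K ?S = (-1) ^ card internal * 2 ^ (2 * (card internal - 1))"
  proof -
    have "(\<Prod>v\<in>internal. wt v) = wt q * (\<Prod>v\<in>internal - {q}. wt v)"
      by (rule prod.remove[OF finite_internal q_internal])
    also have "(\<Prod>v\<in>internal - {q}. wt v) = (\<Prod>v\<in>internal - {q}. 2)"
      by (intro prod.cong) (auto simp: wt_def)
    finally have "(\<Prod>v\<in>internal. wt v) = 2 ^ (card internal - 1)"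
      using finite_internal q_internal by (simp add: wt_def)
    then show ?thesis
      unfolding index_def det_on_hyperbolic_blocks[OF finite_internal] by (simp flip: power_mult add: mult.commute)
  qed
  \<comment> \<open>Applying \<open>?S\<close> exchanges the two slots of a plane and scales by its
    weight, which turns the coordinate formula into a product of matrices.\<close>
  have SU: "(\<Sum>k\<in>?K. ?S l k * f k) = wt (fst l) * f (fst l, \<not> snd l)" if "l \<in> ?K" for l f
  proof -
    have "(\<Sum>k\<in>?K. ?S l k * f k) = (\<Sum>k\<in>?K. if k = (fst l, \<not> snd l) then wt (fst l) * f k else 0)"
      by (intro sum.cong refl) auto
    then show ?thesis using that finK by (auto simp: index_def)
  qed
  have "det_on ?B ?M = det_on ?K (\<lambda>i j. ?M (row i) (row j))"
    by (rule det_on_reindex) (use inj_row finK in \<open>auto simp: bij_betw_def\<close>)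
  also have "\<dots> = det_on ?K (\<lambda>i j. \<Sum>l\<in>?K. ?U i l * (\<Sum>k\<in>?K. ?S l k * ?U j k))"
  proof (rule det_on_cong)
    fix i j assume "i \<in> ?K" "j \<in> ?K"
    then have "?M (row i) (row j) = (\<Sum>l\<in>?K. ?U i l * (wt (fst l) * ?U j (fst l, \<not> snd l)))"
      by (intro max4pc_eq_coord row_in_pairs)
    also have "\<dots> = (\<Sum>l\<in>?K. ?U i l * (\<Sum>k\<in>?K. ?S l k * ?U j k))"
      using SU by (intro sum.cong) auto
    finally show "?M (row i) (row j) = (\<Sum>l\<in>?K. ?U i l * (\<Sum>k\<in>?K. ?S l k * ?U j k))" .
  qed
  also have "\<dots> = det_on ?K ?U * (det_on ?K ?S * det_on ?K (\<lambda>k j. ?U j k))"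
    unfolding det_on_mult[OF finK, of ?U "\<lambda>l j. \<Sum>k\<in>?K. ?S l k * ?U j k"]
      det_on_mult[OF finK, of ?S "\<lambda>k j. ?U j k"] ..
  also have "\<dots> = (det_on ?K ?U)\<^sup>2 * det_on ?K ?S"
    unfolding det_on_transpose[OF finK, of ?U] by (simp add: power2_eq_square)
  finally show det: "det_on ?B ?M = (-1) ^ card internal * 2 ^ (2 * (card internal - 1))"
    unfolding detU detS by simp
  have sub: "?B \<subseteq> pairs V" using row_in_pairs by auto
  have "rows_indep (pairs V) ?B ?M"
    unfolding rows_indep_def
  proof (intro allI impI ballI)
    fix c w assume c: "\<forall>y\<in>pairs V. (\<Sum>w\<in>?B. c w * ?M w y) = 0" and w: "w \<in> ?B"
    \<comment> \<open>The columns indexed by \<open>?B\<close> alone already force this, as the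
      square part has nonzero determinant.\<close>
    show "c w = 0"
      by (rule det_on_nonzero_kernel[of ?B ?M]) (use finK det c w sub in auto)
  qed
  moreover have "rows_span (pairs V) ?B ?M"
    unfolding rows_span_def
  proof (intro ballI)
    fix P assume P: "P \<in> pairs V"
    \<comment> \<open>The coordinates of \<open>P\<close> are a combination of unit rows, and
      \<open>C\<close> expresses each unit row by output rows; \<open>a\<close> composes the
      two.\<close>
    define a where "a = (\<lambda>i. \<Sum>l\<in>?K. coord P l * C l i)"
    have a: "coord P j = (\<Sum>i\<in>?K. a i * ?U i j)" if j: "j \<in> ?K" for j
    proof -
      have "(\<Sum>i\<in>?K. a i * ?U i j) = (\<Sum>i\<in>?K. \<Sum>l\<in>?K. coord P l * (C l i * ?U i j))"
        unfolding a_def sum_distrib_right by (simp add: mult.assoc)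
      also have "\<dots> = (\<Sum>l\<in>?K. coord P l * unit_row l j)"
        using C j by (subst sum.swap) (simp add: sum_distrib_left)
      also have "\<dots> = (\<Sum>l\<in>?K. if l = j then coord P j else 0)" by (intro sum.cong) auto
      finally show ?thesis using j finK by simp
    qed
    show "\<exists>c. \<forall>Q\<in>pairs V. ?M P Q = (\<Sum>w\<in>?B. c w * ?M w Q)"
    proof (intro exI ballI)
      fix Q assume Q: "Q \<in> pairs V"
      let ?g = "\<lambda>k. wt (fst k) * coord Q (fst k, \<not> snd k)"
      have "?M P Q = (\<Sum>k\<in>?K. (\<Sum>i\<in>?K. a i * ?U i k) * ?g k)"
        unfolding max4pc_eq_coord[OF P Q] using a by (intro sum.cong) auto
      also have "\<dots> = (\<Sum>i\<in>?K. a i * (\<Sum>k\<in>?K. ?U i k * ?g k))"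
        unfolding sum_distrib_right sum_distrib_left by (subst sum.swap) (simp add: mult.assoc)
      also have "\<dots> = (\<Sum>i\<in>?K. a i * ?M (row i) Q)"
        using max4pc_eq_coord[OF row_in_pairs Q] by (intro sum.cong) auto
      also have "\<dots> = (\<Sum>w\<in>?B. a (inv_into ?K row w) * ?M w Q)"
        by (simp add: sum.reindex[OF inj_row] inv_into_f_f[OF inj_row])
      finally show "?M P Q = (\<Sum>w\<in>?B. a (inv_into ?K row w) * ?M w Q)" .
    qed
  qed
  ultimately show "rows_basis (pairs V) ?B ?M" using sub by (simp add: rows_basis_def)
qed

end

section \<open>The hypotheses of the theorem in terms of the rooted tree\<close>

lemma tdeg_1_unique:
  assumes "tdeg E x = 1" "e \<in> E" "x \<in> e" "f \<in> E" "x \<in> f"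
  shows "e = f"
proof -
  obtain g where g: "{e \<in> E. x \<in> e} = {g}"
    using assms(1) unfolding tdeg_def by (rule card_1_singletonE)
  have "e \<in> {e \<in> E. x \<in> e}" "f \<in> {e \<in> E. x \<in> e}" using assms by simp_all
  then show ?thesis unfolding g by simp
qed

context rooted_tree
begin

lemma leaves_eq:
  assumes "r \<in> leaves V E" shows "leaves V E = V - internal"
proof -
  have "r \<notin> internal" by (simp add: internal_def)
  then show ?thesis using assms tdeg_nonroot by (auto simp: leaves_def)
qed

lemma card_internal:
  assumes "r \<in> leaves V E" shows "card internal = card V - card (leaves V E)"
proof -
  have sub: "internal \<subseteq> V" using internal_subset by auto
  then have "card (leaves V E) = card V - card internal"
    unfolding leaves_eq[OF assms] by (rule card_Diff_subset[OF finite_internal])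
  then show ?thesis using card_mono[OF fin sub] by simp
qed

lemma leaf_root_child:
  assumes r: "r \<in> leaves V E" and q: "{r, q} \<in> E"
  shows "q \<in> V" "q \<noteq> r" "par q = r" "\<And>v. v \<in> V \<Longrightarrow> v \<noteq> r \<Longrightarrow> par v = r \<Longrightarrow> v = q"
proof -
  have "tdeg E r = 1" using r by (simp add: leaves_def)
  then have only: "e = {r, q}" if "e \<in> E" "r \<in> e" for e
    using that q by (rule tdeg_1_unique) simp
  show q': "q \<in> V" "q \<noteq> r" "par q = r"
    using q by (auto elim!: edge_cases simp: par_r)
  fix v assume "v \<in> V" "v \<noteq> r" "par v = r"
  then have "{v, r} = {r, q}" using parent_edge[of v] by (intro only) auto
  then show "v = q" using \<open>v \<noteq> r\<close> by (auto simp: doubleton_eq_iff)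
qed

text \<open>Some edge avoids \<open>q\<close>, and its upper end is an internal vertex other than
  \<open>q\<close>. A shallowest such vertex must have \<open>q\<close> as its parent.\<close>

lemma nonstar_root_child:
  assumes r: "r \<in> leaves V E" and q: "{r, q} \<in> E" and nstar: "\<not> is_star V E"
  shows "q \<in> internal" "\<exists>c\<in>internal. par c = q"
proof -
  note q' = leaf_root_child[OF r q]
  obtain e where "e \<in> E" "q \<notin> e" using nstar q'(1) by (auto simp: is_star_def)
  then obtain w where w: "w \<in> V" "w \<noteq> r" "q \<noteq> w" "q \<noteq> par w" by (auto elim: edgeE)
  have "par w \<noteq> r" using w q'(4) by auto
  then have "par w \<in> internal - {q}" using w par_internal by auto
  then obtain u where u: "u \<in> internal - {q}" "\<And>x. x \<in> internal - {q} \<Longrightarrow> dep u \<le> dep x"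
    using exists_least_iff[of "\<lambda>k. \<exists>u\<in>internal - {q}. dep u = k"] by (metis not_le)
  have uV: "u \<in> V" "u \<noteq> r" using u internal_subset by auto
  have "par u \<noteq> r" using q'(4) u uV by auto
  then have "par u \<in> internal" using par_internal uV by auto
  moreover have "par u \<notin> internal - {q}" using u(2)[of "par u"] dep_par[OF uV] by auto
  ultimately have "par u = q" by auto
  then show "q \<in> internal" "\<exists>c\<in>internal. par c = q" using \<open>par u \<in> internal\<close> u by auto
qed

text \<open>Two distinct edges can only meet in a vertex of degree different from 1, which is
  internal, so restricting adjacency to internal vertices changes nothing at the start.\<close>

lemma line_graph_eq:
  assumes r: "r \<in> leaves V E" and q: "{r, q} \<in> E" and qI: "q \<in> internal"
  shows "line_graph E = (rest_verts internal, rest_edges internal)"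
proof -
  note q' = leaf_root_child[OF r q]
  have "e \<inter> internal \<noteq> {}" if e: "e \<in> E" for e
  proof -
    obtain w where w: "w \<in> V" "w \<noteq> r" "e = {w, par w}" using e by (rule edgeE)
    then show ?thesis using qI q'(4)[of w] par_internal[of w] by (cases "par w = r") auto
  qed
  then have "rest_verts internal = E" by (auto simp: rest_verts_def)
  moreover have "e \<inter> f \<inter> internal \<noteq> {}" if ef: "e \<in> E" "f \<in> E" "e \<noteq> f" "e \<inter> f \<noteq> {}" for e f
  proof -
    obtain x where x: "x \<in> e" "x \<in> f" using ef by auto
    have "tdeg E x \<noteq> 1" using tdeg_1_unique[of E x e f] x ef by auto
    moreover have "x \<in> V" using x ef edge_in_V by (auto elim!: edgeE simp: par_in)
    ultimately have "x \<in> internal" using leaves_eq[OF r] by (auto simp: leaves_def)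
    then show ?thesis using x by auto
  qed
  then have "(e \<in> E \<and> f \<in> E \<and> e \<noteq> f \<and> e \<inter> f \<inter> internal \<noteq> {})
      \<longleftrightarrow> (e \<in> E \<and> f \<in> E \<and> e \<noteq> f \<and> e \<inter> f \<noteq> {})" for e f by blast
  then have "rest_edges internal = {{e, f} | e f. e \<in> E \<and> f \<in> E \<and> e \<noteq> f \<and> e \<inter> f \<noteq> {}}"
    unfolding rest_edges_def by (simp only:)
  ultimately show ?thesis by (simp add: line_graph_def)
qed

lemma initial_state:
  assumes r: "r \<in> leaves V E" and q: "{r, q} \<in> E" and qI: "q \<in> internal"
  shows "state internal q {}"
proof -
  note q' = leaf_root_child[OF r q]
  have "r \<notin> internal" by (simp add: internal_def)
  moreover have "{u \<in> internal. par u \<notin> internal \<and> u \<noteq> q} = {}"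
    using q'(4) par_internal internal_subset by blast
  ultimately show ?thesis using qI q'(3) unfolding state_def by (simp only:) simp
qed

end

theorem theorem2:
  fixes V :: "'a set" and E :: "'a set set" and B :: "'a set set" and n p :: nat
  assumes "is_tree V E"
    and "n = card V" and "n \<ge> 4"
    and "p = card (leaves V E)"
    and "\<not> is_star V E"
    and "alg_output V E B"
  shows "card B = 2 * (n - p)
       \<and> rows_basis (pairs V) B (max4pc E)
       \<and> det_on B (max4pc E) = (-1) ^ (n - p) * 2 ^ (2 * (n - p - 1))"
proof -
  obtain r q where r: "r \<in> leaves V E" and q: "{r, q} \<in> E"
    and run: "alg_run (line_graph E) {} {r, q} {} B"
    using assms(6) by (auto simp: alg_output_def)
  have "r \<in> V" using r by (simp add: leaves_def)
  then obtain par dep where "rooted_tree V E r par dep"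
    using tree_rooted[OF assms(1)] by blast
  then interpret rooted_tree V E r par dep .
  note q' = leaf_root_child[OF r q] and qI = nonstar_root_child[OF r q assms(5)]
  have "{r, q} = {q, par q}" using q'(3) by auto
  then obtain ch where out: "child_choice internal ch"
    "B = (\<Union>u\<in>internal. {{u, par u}, second_pair ch u})"
    using alg_run_output[OF run line_graph_eq[OF r q qI(1)] _ initial_state[OF r q qI(1)]] by auto
  have ch_q: "ch q \<in> internal" using out(1) qI by (auto simp: child_choice_def)
  interpret chosen_tree V E r par dep q ch
    by unfold_locales (fact qI(1) q'(3,4) out(1) ch_q)+
  have "B = row ` index"
    unfolding out(2) row_image ..
  then show ?thesis
    using row_basis_and_det card_internal[OF r] assms(2,4) by simp
qed

end
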